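(* Let $A\in\mathbb{C}^{n\times n}$ have Weyr characteristic $\eta_m(A,\lambda)$, and let $k\in\mathbb{N}$. Then, as $R$ ranges over all complex $n\times n$ matrices of rank less than or equal to $k$, the Weyr characteristics assumed by the matrix $B=A+R$ are precisely those that satisfy both of the following conditions: (i) for any $\lambda\in\mathbb{C}$ and any integer $m\ge 1$, $|\eta_m(A,\lambda)-\eta_m(B,\lambda)|\le k$; (ii) $\sum_{\lambda\in\mathbb{C}}\sum_{m\ge 1}\eta_m(B,\lambda)=n$. That is, a function $(m,\lambda)\mapsto\mu_m(\lambda)$ from $\{1,2,\dots\}\times\mathbb{C}$ to $\mathbb{N}$ that has finite support and satisfies $\mu_m(\lambda)\ge\mu_{m+1}(\lambda)$ for all $m,\lambda$ is equal to the Weyr characteristic of $A+R$ for some $R\in\mathbb{C}^{n\times n}$ with $\operatorname{rank}(R)\le k$ if and only if $|\eta_m(A,\lambda)-\mu_m(\lambda)|\le k$ for all $m\ge1$, $\lambda\in\mathbb{C}$, and $\sum_{\lambda\in\mathbb{C}}\sum_{m\ge1}\mu_m(\lambda)=n$.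
   Context: $\mathbb{N}=\{0,1,2,\dots\}$. For $A\in\mathbb{C}^{n\times n}$, $\lambda\in\mathbb{C}$ and an integer $m\ge1$, $\eta_m(A,\lambda)$ denotes the number of Jordan blocks of $A$ with eigenvalue $\lambda$ and of size greater than or equal to $m$; equivalently $\eta_m(A,\lambda)=\dim\ker(\lambda E-A)^m-\dim\ker(\lambda E-A)^{m-1}$, where $E$ is the identity matrix. The function $(m,\lambda)\mapsto\eta_m(A,\lambda)$ is the Weyr characteristic (Weyr invariants) of $A$. *)

theory Defs
  imports
    "Jordan_Normal_Form.DL_Rank"
    "Jordan_Normal_Form.Jordan_Normal_Form_Uniqueness"
    "Jordan_Normal_Form.Jordan_Normal_Form_Existence"
    "Jordan_Normal_Form.Spectral_Radius"
begin

text \<open>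
  A list \<open>n_as\<close> with \<open>jordan_nf A n_as\<close> holds one pair (size, eigenvalue) per Jordan block,
  every size being positive. It is unique only up to reordering, so the definition fixes one such
  list; by \<open>weyr_jordan_nf\<close> below, the value does not depend on that choice.
\<close>

definition weyr :: "complex mat \<Rightarrow> nat \<Rightarrow> complex \<Rightarrow> nat" where
  "weyr A m ev =
     length (filter (\<lambda>(s, e). e = ev \<and> m \<le> s) (SOME n_as. jordan_nf A n_as))"

lemma complex_jordan_nf_exists:
  fixes A :: "complex mat"
  assumes A: "A \<in> carrier_mat n n"
  shows "\<exists>n_as. jordan_nf A n_as"
proof -
  obtain as where "char_poly A = (\<Prod> a \<leftarrow> as. [:- a, 1:])"
    using char_poly_factorized[OF A] by blast
  then show ?thesis by (rule jordan_nf_exists[OF A])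
qed

lemma length_filter_blocks:
  assumes "m \<ge> 1"
  shows "(\<Sum>s \<leftarrow> map fst (filter (\<lambda>(s, e). e = ev) n_as). min m s)
       = (\<Sum>s \<leftarrow> map fst (filter (\<lambda>(s, e). e = ev) n_as). min (m - 1) s)
         + length (filter (\<lambda>(s, e). e = ev \<and> m \<le> s) n_as)"
proof (induction n_as)
  case Nil
  show ?case by simp
next
  case (Cons p n_as)
  show ?case using Cons assms by (cases p) auto
qed

lemma weyr_jordan_nf:
  assumes "jordan_nf A n_as" and "m \<ge> 1"
  shows "weyr A m ev = length (filter (\<lambda>(s, e). e = ev \<and> m \<le> s) n_as)"
proof -
  have some: "jordan_nf A (SOME n_as. jordan_nf A n_as)"
    using assms(1) by (rule someI)
  show ?thesis
    using length_filter_blocks[OF assms(2), of ev "SOME n_as. jordan_nf A n_as"]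
      length_filter_blocks[OF assms(2), of ev n_as]
    unfolding weyr_def dim_gen_eigenspace[OF some, symmetric]
      dim_gen_eigenspace[OF assms(1), symmetric]
    by simp
qed

lemma weyr_dim_gen_eigenspace:
  assumes "A \<in> carrier_mat n n" and "m \<ge> 1"
  shows "int (weyr A m ev) = int (dim_gen_eigenspace A ev m) - int (dim_gen_eigenspace A ev (m - 1))"
proof -
  obtain n_as where jnf: "jordan_nf A n_as"
    using complex_jordan_nf_exists[OF assms(1)] by blast
  show ?thesis
    using length_filter_blocks[OF assms(2), of ev n_as] weyr_jordan_nf[OF jnf assms(2), of ev]
    unfolding dim_gen_eigenspace[OF jnf, symmetric]
    by simp
qed

end

(*
  Necessity. After a shift take the eigenvalue to be 0, let f_1, ..., f_k be functionals whose common
  kernel lies in ker R, and let L_m be the set of x in ker A^m with f_l (A^j x) = 0 for all j and l.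
  On L_m the powers of A and B = A + R agree, so L_m / L_(m-1) embeds in ker B^m / ker B^(m-1).
  Conversely ker A^m = L_m + ker A^(m-1) + span Z with |Z| <= k: for one functional f choose x and j
  with f (A^j x) nonzero and j maximal; then every y becomes annihilated by all f A^i after
  subtracting a combination of x, A x, ..., A^j x, and A x, A^2 x, ... lie in ker A^(m-1).

  Sufficiency. Going a fraction 1/k of the way from the Weyr characteristic of A to the prescribed
  one and rounding reduces the claim to k = 1. Let a and b be the two characteristics and let
  s_1 >= s_2 >= ... be the Jordan block sizes (for some eigenvalue) belonging to min a b, and
  t_1 >= t_2 >= ... those of a; then s_i <= t_i and t_(i+1) <= s_i. Block by block one
  builds a matrix G similar to A and a vector u such that (G, u) is feedback equivalent to
  (M, w) with M = J(s) + J_d(0) (direct sum) and w the last unit vector: G is similar to M + w r for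
  some row r. The same (M, w) serves for b, and M + w r, M + w r' differ by a matrix of rank one.
*)

theory Submission
  imports Defs
begin

section \<open>Feedback equivalence\<close>

text \<open>For every row \<open>r\<close> the pair \<open>(G + u * r, u)\<close> is feedback
  equivalent to \<open>(G, u)\<close>, so one class of pairs holds a whole family of rank one
  perturbations. Feedback cannot change the part that the input does not reach, while the reachable
  part is a single chain in which all eigenvalues are forgotten. Hence the two characteristics only
  have to share their unreachable part.

  The difficulty is to know \<open>G\<close> up to similarity and \<open>(G, u)\<close> up to
  feedback at once. A Jordan block glued on through \<open>u\<close> makes the second easy and hides
  the first: the block splits off by similarity if \<open>u\<close> is a t-th image under G - ev,
  where t is its size. Keeping this true from one block to the next is what consumes t_(i+1) <= s_i,
  and it is why the blocks of one eigenvalue are attached from the largest to the smallest. At a new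
  eigenvalue it is automatic, because G - ev is invertible.

  In the reduction to rank one, the rounded function must stay decreasing and keep the total n
  exactly. No rounding rule is given: a lower and an upper bound have totals on both sides of n, and
  an intermediate value argument does the rest.\<close>

text \<open>Inputs \<open>u\<close>, \<open>w\<close> and feedback \<open>r\<close> are matrices with one column, respectively one row, so that
  everything can be computed with block matrices.\<close>

definition feedback_equiv :: "nat \<Rightarrow> 'a :: comm_ring_1 mat \<Rightarrow> 'a mat \<Rightarrow> 'a mat \<Rightarrow> 'a mat \<Rightarrow> bool" where
  "feedback_equiv n G u M w \<longleftrightarrow>
     G \<in> carrier_mat n n \<and> u \<in> carrier_mat n 1 \<and> M \<in> carrier_mat n n \<and> w \<in> carrier_mat n 1 \<and>
     (\<exists>P Q r. P \<in> carrier_mat n n \<and> Q \<in> carrier_mat n n \<and> r \<in> carrier_mat 1 n \<and>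
        P * Q = 1\<^sub>m n \<and> Q * P = 1\<^sub>m n \<and> P * G = M * P + w * r \<and> P * u = w)"

lemma feedback_equivI:
  assumes "G \<in> carrier_mat n n" "u \<in> carrier_mat n 1" "M \<in> carrier_mat n n" "w \<in> carrier_mat n 1"
    "P \<in> carrier_mat n n" "Q \<in> carrier_mat n n" "r \<in> carrier_mat 1 n"
    "P * Q = 1\<^sub>m n" "Q * P = 1\<^sub>m n" "P * G = M * P + w * r" "P * u = w"
  shows "feedback_equiv n G u M w"
  using assms unfolding feedback_equiv_def by blast

lemma feedback_equivE:
  assumes "feedback_equiv n G u M w"
  obtains P Q r where "G \<in> carrier_mat n n" "u \<in> carrier_mat n 1" "M \<in> carrier_mat n n"
    "w \<in> carrier_mat n 1" "P \<in> carrier_mat n n" "Q \<in> carrier_mat n n" "r \<in> carrier_mat 1 n"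
    "P * Q = 1\<^sub>m n" "Q * P = 1\<^sub>m n" "P * G = M * P + w * r" "P * u = w"
  using assms unfolding feedback_equiv_def by blast

lemma feedback_equiv_similar:
  assumes GM: "similar_mat_wit G M Q P" and G: "G \<in> carrier_mat n n"
    and u: "u \<in> carrier_mat n 1"
  shows "feedback_equiv n G u M (P * u)"
proof -
  note w = similar_mat_witD2[OF G GM]
  have "P * G = P * (Q * M * P)" using w by simp
  also have "\<dots> = P * (Q * (M * P))" using w by simp
  also have "\<dots> = (P * Q) * (M * P)" using w by (intro assoc_mult_mat[symmetric]) auto
  also have "\<dots> = M * P" using w by simp
  also have "\<dots> = M * P + (P * u) * 0\<^sub>m 1 n"
    using w u by (simp add: right_mult_zero_mat[of _ n 1] right_add_zero_mat[of _ n n])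
  finally show ?thesis using w u
    by (intro feedback_equivI[where P = P and Q = Q and r = "0\<^sub>m 1 n"]) auto
qed

lemma feedback_equiv_trans:
  assumes "feedback_equiv n G u M w" "feedback_equiv n M w K z"
  shows "feedback_equiv n G u K z"
proof -
  from assms(1) obtain P Q r where c: "G \<in> carrier_mat n n" "u \<in> carrier_mat n 1" "M \<in> carrier_mat n n"
    "w \<in> carrier_mat n 1" "P \<in> carrier_mat n n" "Q \<in> carrier_mat n n" "r \<in> carrier_mat 1 n"
    and 1: "P * Q = 1\<^sub>m n" "Q * P = 1\<^sub>m n" "P * G = M * P + w * r" "P * u = w"
    by (rule feedback_equivE)
  from assms(2) obtain P' Q' r' where c': "K \<in> carrier_mat n n"
    "z \<in> carrier_mat n 1" "P' \<in> carrier_mat n n" "Q' \<in> carrier_mat n n" "r' \<in> carrier_mat 1 n"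
    and 2: "P' * Q' = 1\<^sub>m n" "Q' * P' = 1\<^sub>m n" "P' * M = K * P' + z * r'" "P' * w = z"
    by (rule feedback_equivE)
  have a: "P' * P * (Q * Q') = 1\<^sub>m n"
  proof -
    have "P' * P * (Q * Q') = P' * (P * Q) * Q'"
      using c c' by (simp add: assoc_mult_mat[of _ n n _ n _ n])
    then show ?thesis using 1 2 c' by simp
  qed
  have b: "Q * Q' * (P' * P) = 1\<^sub>m n"
  proof -
    have "Q * Q' * (P' * P) = Q * (Q' * P') * P"
      using c c' by (simp add: assoc_mult_mat[of _ n n _ n _ n])
    then show ?thesis using 1 2 c by simp
  qed
  have "P' * P * G = P' * (M * P + w * r)"
    using c c' 1 by simp
  also have "\<dots> = P' * (M * P) + P' * (w * r)"
    using c c' by (intro mult_add_distrib_mat) auto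
  also have "P' * (w * r) = z * r" using c c' 2(4) by (simp flip: assoc_mult_mat)
  also have "P' * (M * P) = (K * P' + z * r') * P" using c c' 2(3) by (simp flip: assoc_mult_mat)
  also have "\<dots> = K * P' * P + z * r' * P"
    using c c' by (intro add_mult_distrib_mat) auto
  also have "K * P' * P = K * (P' * P)" using c c' by simp
  also have "z * r' * P = z * (r' * P)" using c c' by (intro assoc_mult_mat) auto
  also have "K * (P' * P) + z * (r' * P) + z * r = K * (P' * P) + (z * (r' * P) + z * r)"
    using c c' by (intro assoc_add_mat) auto
  also have "z * (r' * P) + z * r = z * (r' * P + r)"
    using c c' by (intro mult_add_distrib_mat[symmetric]) auto
  finally have d: "P' * P * G = K * (P' * P) + z * (r' * P + r)" .
  have "P' * P * u = z" using c c' 1 2 by simp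
  with a b d c c' show ?thesis
    by (intro feedback_equivI[where P = "P' * P" and Q = "Q * Q'" and r = "r' * P + r"]) auto
qed

definition last_unit :: "nat \<Rightarrow> 'a :: {zero,one} mat" where
  "last_unit n = mat n 1 (\<lambda>(i, j). if Suc i = n then 1 else 0)"

lemma last_unit_carrier [simp]: "last_unit n \<in> carrier_mat n 1"
  by (simp add: last_unit_def)

lemmas last_unit_carrier_Suc [simp] = last_unit_carrier[simplified]

lemma last_unit_four_block:
  "last_unit (n + 1) = four_block_mat (0\<^sub>m n 1) (0\<^sub>m n 0) (1\<^sub>m 1) (0\<^sub>m 1 0)"
  by (rule eq_matI) (auto simp: last_unit_def)

text \<open>The pair \<open>(P, r)\<close> for the given equivalence yields the new transformation with rows
  \<open>(P, 0)\<close> and \<open>(r, 1)\<close>; the diagonal entry \<open>c\<close> is absorbed by the feedback.\<close>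

lemma feedback_equiv_box:
  assumes "feedback_equiv n G u M w" and c: "c \<in> carrier_mat 1 1"
  shows "feedback_equiv (n + 1) (four_block_mat G u (0\<^sub>m 1 n) c) (last_unit (n + 1))
           (four_block_mat M w (0\<^sub>m 1 n) (0\<^sub>m 1 1)) (last_unit (n + 1))"
proof -
  from assms(1) obtain P Q r where
    G: "G \<in> carrier_mat n n" and u: "u \<in> carrier_mat n 1" and M: "M \<in> carrier_mat n n"
    and w: "w \<in> carrier_mat n 1" and P: "P \<in> carrier_mat n n" and Q: "Q \<in> carrier_mat n n"
    and r: "r \<in> carrier_mat 1 n"
    and 1: "P * Q = 1\<^sub>m n" "Q * P = 1\<^sub>m n" "P * G = M * P + w * r" "P * u = w"
    by (rule feedback_equivE)
  let ?P = "four_block_mat P (0\<^sub>m n 1) r (1\<^sub>m 1)"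
  let ?Q = "four_block_mat Q (0\<^sub>m n 1) (- (r * Q)) (1\<^sub>m 1)"
  let ?G = "four_block_mat G u (0\<^sub>m 1 n) c"
  let ?M = "four_block_mat M w (0\<^sub>m 1 n) (0\<^sub>m 1 1)"
  \<comment> \<open>The bottom row of \<open>?P * ?G\<close>, which feedback must supply because
    \<open>?M\<close> has bottom row zero. Blocks of height or width 0 let rows and columns take
    part in the block product rule.\<close>
  let ?r = "four_block_mat (r * G) (r * u + c) (0\<^sub>m 0 n) (0\<^sub>m 0 1)"
  let ?l = "four_block_mat (0\<^sub>m n 1) (0\<^sub>m n 0) (1\<^sub>m 1) (0\<^sub>m 1 0)"
  have PQ: "?P * ?Q = 1\<^sub>m (n + 1)"
    using P Q r 1
    by (subst mult_four_block_mat[of _ n n _ 1 _ 1 _ _ n _ 1]) (auto simp flip: four_block_one_mat intro!: cong_four_block_mat)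
  have QP: "?Q * ?P = 1\<^sub>m (n + 1)"
  proof -
    have "- (r * Q) * P = - r"
      using P Q r 1 by simp
    then show ?thesis
    using P Q r 1
    by (subst mult_four_block_mat[of _ n n _ 1 _ 1 _ _ n _ 1]) (auto simp flip: four_block_one_mat intro!: cong_four_block_mat)
  qed
  have PG: "?P * ?G = four_block_mat (M * P + w * r) w (r * G) (r * u + c)"
    using P r G u c 1
    by (subst mult_four_block_mat[of _ n n _ 1 _ 1 _ _ n _ 1]) (auto intro!: cong_four_block_mat)
  have MP: "?M * ?P = four_block_mat (M * P + w * r) w (0\<^sub>m 1 n) (0\<^sub>m 1 1)"
    using P r M w
    by (subst mult_four_block_mat[of _ n n _ 1 _ 1 _ _ n _ 1]) (auto intro!: cong_four_block_mat)
  have lr: "?l * ?r = four_block_mat (0\<^sub>m n n) (0\<^sub>m n 1) (r * G) (r * u + c)"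
    using r u c G
    by (subst mult_four_block_mat[of _ n 1 _ 0 _ 1 _ _ n _ 1]) (auto intro!: cong_four_block_mat)
  have e: "?P * ?G = ?M * ?P + ?l * ?r"
    unfolding PG MP lr using M P w r G u c
    by (subst add_four_block_mat[of _ n n _ 1 _ 1]) (auto intro!: cong_four_block_mat)
  have "?P * ?l = ?l"
    using P r
    by (subst mult_four_block_mat[of _ n n _ 1 _ 1 _ _ 1 _ 0]) (auto intro!: cong_four_block_mat)
  with PQ QP e show ?thesis unfolding last_unit_four_block
    using P Q r G M c u w
    by (intro feedback_equivI[where P = ?P and Q = ?Q and r = ?r]) auto
qed

text \<open>The coupling \<open>u * x\<close> lies in the range of the input, so the feedback row
  with entries \<open>x\<close> and \<open>r\<close> removes it. What remains is \<open>K\<close> as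
  a summand that the input does not reach.\<close>

lemma feedback_equiv_block:
  assumes "feedback_equiv n G u M w" and K: "K \<in> carrier_mat k k" and x: "x \<in> carrier_mat 1 k"
  shows "feedback_equiv (k + n) (four_block_mat K (0\<^sub>m k n) (u * x) G) (0\<^sub>m k 1 @\<^sub>r u)
           (four_block_mat K (0\<^sub>m k n) (0\<^sub>m n k) M) (0\<^sub>m k 1 @\<^sub>r w)"
proof -
  from assms(1) obtain P Q r where
    G: "G \<in> carrier_mat n n" and u: "u \<in> carrier_mat n 1" and M: "M \<in> carrier_mat n n"
    and w: "w \<in> carrier_mat n 1" and P: "P \<in> carrier_mat n n" and Q: "Q \<in> carrier_mat n n"
    and r: "r \<in> carrier_mat 1 n"
    and 1: "P * Q = 1\<^sub>m n" "Q * P = 1\<^sub>m n" "P * G = M * P + w * r" "P * u = w"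
    by (rule feedback_equivE)
  let ?P = "four_block_mat (1\<^sub>m k) (0\<^sub>m k n) (0\<^sub>m n k) P"
  let ?Q = "four_block_mat (1\<^sub>m k) (0\<^sub>m k n) (0\<^sub>m n k) Q"
  let ?G = "four_block_mat K (0\<^sub>m k n) (u * x) G"
  let ?M = "four_block_mat K (0\<^sub>m k n) (0\<^sub>m n k) M"
  let ?r = "four_block_mat x r (0\<^sub>m 0 k) (0\<^sub>m 0 n)"
  have PQ: "?P * ?Q = 1\<^sub>m (k + n)"
    using P Q 1
    by (subst mult_four_block_mat[of _ k k _ n _ n _ _ k _ n]) (auto simp flip: four_block_one_mat intro!: cong_four_block_mat)
  have QP: "?Q * ?P = 1\<^sub>m (k + n)"
    using P Q 1
    by (subst mult_four_block_mat[of _ k k _ n _ n _ _ k _ n]) (auto simp flip: four_block_one_mat intro!: cong_four_block_mat)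
  have Pux: "P * (u * x) = w * x" using P u x 1 by (simp flip: assoc_mult_mat)
  have PG: "?P * ?G = four_block_mat K (0\<^sub>m k n) (w * x) (M * P + w * r)"
    using P G M w r u x K 1(3) Pux
    by (subst mult_four_block_mat[of _ k k _ n _ n _ _ k _ n]) (auto intro!: cong_four_block_mat)
  have MP: "?M * ?P = four_block_mat K (0\<^sub>m k n) (0\<^sub>m n k) (M * P)"
    using P M K
    by (subst mult_four_block_mat[of _ k k _ n _ n _ _ k _ n]) (auto intro!: cong_four_block_mat)
  have wr: "(0\<^sub>m k 1 @\<^sub>r w) * ?r = four_block_mat (0\<^sub>m k k) (0\<^sub>m k n) (w * x) (w * r)"
    unfolding append_rows_def using w x r
    by (subst mult_four_block_mat[of _ k 1 _ 0 _ n _ _ k _ n]) (auto intro!: cong_four_block_mat)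
  have e: "?P * ?G = ?M * ?P + (0\<^sub>m k 1 @\<^sub>r w) * ?r"
    unfolding PG MP wr using M P w r x K
    by (subst add_four_block_mat[of _ k k _ n _ n]) (auto intro!: cong_four_block_mat)
  have "?P * (0\<^sub>m k 1 @\<^sub>r u) = 0\<^sub>m k 1 @\<^sub>r w"
    unfolding append_rows_def using P u 1 w
    by (subst mult_four_block_mat[of _ k k _ n _ n _ _ 1 _ 0]) (auto intro!: cong_four_block_mat)
  with PQ QP e show ?thesis
    using P Q r G M K u w x
    by (intro feedback_equivI[where P = ?P and Q = ?Q and r = ?r]) auto
qed

text \<open>The transformation is given explicitly because its effect on the input vector has to be
  computed later.\<close>

lemma similar_mat_wit_swap_blocks:
  fixes A :: "'a :: comm_ring_1 mat"
  assumes A: "A \<in> carrier_mat n n" and B: "B \<in> carrier_mat n m"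
    and C: "C \<in> carrier_mat m n" and D: "D \<in> carrier_mat m m"
  shows "similar_mat_wit (four_block_mat A B C D) (four_block_mat D C B A)
    (four_block_mat (0\<^sub>m n m) (1\<^sub>m n) (1\<^sub>m m) (0\<^sub>m m n))
    (four_block_mat (0\<^sub>m m n) (1\<^sub>m m) (1\<^sub>m n) (0\<^sub>m n m))"
    (is "similar_mat_wit ?M ?N ?P ?Q")
proof -
  have PN: "?P * ?N = four_block_mat B A D C"
    using assms
    by (subst mult_four_block_mat[of _ n m _ n _ m _ _ m _ n]) (auto intro!: cong_four_block_mat)
  have "?P * ?N * ?Q = ?M"
    unfolding PN using assms
    by (subst mult_four_block_mat[of _ n m _ n _ m _ _ n _ m]) (auto intro!: cong_four_block_mat)
  moreover have "?P * ?Q = 1\<^sub>m (n + m)"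
    by (subst mult_four_block_mat[of _ n m _ n _ m _ _ n _ m]) (auto simp flip: four_block_one_mat intro!: cong_four_block_mat)
  moreover have "?Q * ?P = 1\<^sub>m (n + m)"
    by (subst mult_four_block_mat[of _ m n _ m _ n _ _ m _ n]) (auto simp: add.commute simp flip: four_block_one_mat intro!: cong_four_block_mat)
  ultimately show ?thesis
    using assms by (intro similar_mat_witI[of _ _ "n + m"]) (auto intro!: carrier_matI)
qed

lemma similar_mat_swap_diag_blocks:
  fixes A :: "'a :: comm_ring_1 mat"
  assumes "A \<in> carrier_mat n n" and "D \<in> carrier_mat m m"
  shows "similar_mat (four_block_mat A (0\<^sub>m n m) (0\<^sub>m m n) D) (four_block_mat D (0\<^sub>m m n) (0\<^sub>m n m) A)"
  using similar_mat_wit_swap_blocks[OF assms(1) zero_carrier_mat zero_carrier_mat assms(2)]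
  unfolding similar_mat_def by blast

definition first_row :: "nat \<Rightarrow> 'a :: {zero,one} mat" where
  "first_row n = mat 1 n (\<lambda>(i, j). if j = 0 then 1 else 0)"

lemma first_row_carrier [simp]: "first_row n \<in> carrier_mat 1 n"
  by (simp add: first_row_def)

lemmas first_row_carrier_Suc [simp] = first_row_carrier[simplified]

section \<open>Attaching a Jordan block\<close>

text \<open>The first column of the block is its eigenvector column. Coupling \<open>u\<close> there
  makes the chain of the block run on into \<open>u\<close>, so that an input at the far end of the
  block reaches whatever \<open>u\<close> reached.\<close>

definition attach_jordan :: "'a :: comm_ring_1 mat \<Rightarrow> 'a mat \<Rightarrow> nat \<Rightarrow> 'a \<Rightarrow> 'a mat" where
  "attach_jordan G u t ev =
     four_block_mat G (u * first_row t) (0\<^sub>m t (dim_row G)) (jordan_block t ev)"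

text \<open>The vectors \<open>chain_vec u t q\<close> for \<open>q = t, ..., 0\<close> form a chain under the shifted matrix
  \<open>attach_jordan G u t ev\<close>: for \<open>q > 0\<close> it is the \<open>q\<close>-th unit vector of the attached block, and for
  \<open>q = 0\<close> it is \<open>u\<close> padded with zeros.\<close>

definition chain_vec :: "'a :: comm_ring_1 mat \<Rightarrow> nat \<Rightarrow> nat \<Rightarrow> 'a mat" where
  "chain_vec u t q = mat (dim_row u + t) 1
     (\<lambda>(i, j). if q = 0 then (if i < dim_row u then u $$ (i, 0) else 0)
               else if Suc i = dim_row u + q then 1 else 0)"

lemma attach_jordan_carrier [simp]:
  "G \<in> carrier_mat n n \<Longrightarrow> attach_jordan G u t ev \<in> carrier_mat (n + t) (n + t)"
  unfolding attach_jordan_def by auto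

lemma chain_vec_carrier [simp]:
  "u \<in> carrier_mat n 1 \<Longrightarrow> chain_vec u t q \<in> carrier_mat (n + t) 1"
  unfolding chain_vec_def by auto

lemmas chain_vec_carrier_Suc [simp] = chain_vec_carrier[simplified]

lemma index_mult_first_row:
  fixes u :: "'a :: comm_ring_1 mat"
  assumes "u \<in> carrier_mat n 1" "i < n" "j < t"
  shows "(u * first_row t) $$ (i, j) = (if j = 0 then u $$ (i, 0) else 0)"
  using assms by (simp add: scalar_prod_def first_row_def)

lemma index_attach_jordan:
  assumes "G \<in> carrier_mat n n" "u \<in> carrier_mat n 1" "i < n + t" "j < n + t"
  shows "attach_jordan G u t ev $$ (i, j) =
    (if j < n then if i < n then G $$ (i, j) else 0
     else if i < n then (if j = n then u $$ (i, 0) else 0)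
     else if i = j then ev else if Suc i = j then 1 else 0)"
proof -
  have d: "dim_row G = n" "dim_col G = n" using assms by auto
  show ?thesis
    using assms unfolding attach_jordan_def
    by (cases "i < n"; cases "j < n")
      (auto simp: d index_mult_first_row[of u n] simp del: index_mult_mat)
qed

lemma index_chain_vec:
  assumes "u \<in> carrier_mat n 1" "i < n + t" "j < 1"
  shows "chain_vec u t q $$ (i, j) =
    (if q = 0 then (if i < n then u $$ (i, 0) else 0) else if Suc i = n + q then 1 else 0)"
  using assms unfolding chain_vec_def by auto

lemma attach_jordan_0:
  assumes "G \<in> carrier_mat n n" "u \<in> carrier_mat n 1"
  shows "attach_jordan G u 0 ev = G" "chain_vec u 0 0 = u"
  using assms
  by (auto intro!: eq_matI simp: index_attach_jordan[of G n] index_chain_vec[of u n] carrier_matD[OF attach_jordan_carrier]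
     carrier_matD[OF chain_vec_carrier])

text \<open>The block grows by one row whose coupling is the current end of the chain, which for
  \<open>t = 0\<close> is \<open>u\<close> itself. This is the shape that
  \<open>feedback_equiv_box\<close> extends.\<close>

lemma attach_jordan_Suc:
  assumes G: "G \<in> carrier_mat n n" and u: "u \<in> carrier_mat n 1"
  shows "attach_jordan G u (Suc t) ev =
    four_block_mat (attach_jordan G u t ev) (chain_vec u t t) (0\<^sub>m 1 (n + t)) (mat 1 1 (\<lambda>_. ev))"
proof -
  have c: "attach_jordan G u t ev \<in> carrier_mat (n + t) (n + t)"
    "attach_jordan G u (Suc t) ev \<in> carrier_mat (n + Suc t) (n + Suc t)"
    "chain_vec u t t \<in> carrier_mat (n + t) 1"
    using attach_jordan_carrier[OF G] chain_vec_carrier[OF u] by blast+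
  show ?thesis
    by (intro eq_matI)
      (auto simp: index_attach_jordan[OF G u] index_chain_vec[OF u] carrier_matD[OF c(1)]
        carrier_matD[OF c(2)] carrier_matD[OF c(3)])
qed

lemma chain_vec_Suc_self:
  assumes "u \<in> carrier_mat n 1"
  shows "chain_vec u (Suc t) (Suc t) = last_unit (n + t + 1)"
  using assms by (intro eq_matI) (auto simp: last_unit_def chain_vec_def)

text \<open>Cutting a Jordan block leaves one superdiagonal entry across the cut, so the lower part
  is in turn attached to the end of the upper chain.\<close>

lemma attach_jordan_four_block:
  assumes G: "G \<in> carrier_mat n n" and u: "u \<in> carrier_mat n 1"
  shows "attach_jordan G u (t + s) ev =
    four_block_mat (attach_jordan G u t ev) (chain_vec u t t * first_row s)
      (0\<^sub>m s (n + t)) (jordan_block s ev)"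
proof -
  have c: "attach_jordan G u t ev \<in> carrier_mat (n + t) (n + t)"
    "attach_jordan G u (t + s) ev \<in> carrier_mat (n + (t + s)) (n + (t + s))"
    "chain_vec u t t \<in> carrier_mat (n + t) 1"
    using attach_jordan_carrier[OF G] chain_vec_carrier[OF u] by blast+
  show ?thesis
    by (intro eq_matI)
      (auto simp: index_attach_jordan[OF G u] index_chain_vec[OF u] carrier_matD[OF c(1)]
        carrier_matD[OF c(2)] carrier_matD[OF c(3)] index_mult_first_row[OF c(3)]
        simp del: index_mult_mat(1))
qed

lemma char_matrix_attach_jordan_mult_chain_vec:
  assumes G: "G \<in> carrier_mat n n" and u: "u \<in> carrier_mat n 1" and q: "q < t"
  shows "char_matrix (attach_jordan G u t ev) ev * chain_vec u t (Suc q) = chain_vec u t q"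
proof -
  let ?H = "char_matrix (attach_jordan G u t ev) ev"
  have c: "attach_jordan G u t ev \<in> carrier_mat (n + t) (n + t)"
    using G by simp
  have H: "?H \<in> carrier_mat (n + t) (n + t)"
    using c by simp
  have z: "chain_vec u t (Suc q) = mat (n + t) 1 (\<lambda>(i, j). if i = n + q then 1 else 0)"
    using u q by (intro eq_matI) (auto simp: chain_vec_def)
  have *: "(?H * chain_vec u t (Suc q)) $$ (i, 0) = ?H $$ (i, n + q)" if "i < n + t" for i
  proof -
    have "(?H * chain_vec u t (Suc q)) $$ (i, 0) = (\<Sum>j = 0..<n + t. ?H $$ (i, j) * (if j = n + q then 1 else 0))"
      unfolding z using that carrier_matD[OF H] by (simp add: scalar_prod_def)
    also have "\<dots> = (\<Sum>j = 0..<n + t. if j = n + q then ?H $$ (i, j) else 0)"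
      by (intro sum.cong) auto
    also have "\<dots> = ?H $$ (i, n + q)" using q by simp
    finally show ?thesis .
  qed
  show ?thesis
  proof (rule eq_matI)
    fix i j assume "i < dim_row (chain_vec u t q)" "j < dim_col (chain_vec u t q)"
    then have i: "i < n + t" and j: "j = 0" using u by (auto simp: chain_vec_def)
    show "(?H * chain_vec u t (Suc q)) $$ (i, j) = chain_vec u t q $$ (i, j)"
      unfolding j *[OF i] using i q
      by (auto simp: char_matrix_def index_attach_jordan[OF G u] index_chain_vec[OF u]
          carrier_matD[OF c])
  qed (use H u in \<open>auto simp: chain_vec_def\<close>)
qed

lemma char_matrix_attach_jordan_pow_mult_chain_vec:
  assumes G: "G \<in> carrier_mat n n" and u: "u \<in> carrier_mat n 1" and "q + s \<le> t"
  shows "char_matrix (attach_jordan G u t ev) ev ^\<^sub>m s * chain_vec u t (q + s) = chain_vec u t q"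
  using assms(3)
proof (induction s)
  case 0
  show ?case using G u
    by (metis add_0_right attach_jordan_carrier chain_vec_carrier char_matrix_def carrier_matD pow_mat.simps(1)
        left_mult_one_mat char_matrix_closed)
next
  case (Suc s)
  let ?H = "char_matrix (attach_jordan G u t ev) ev"
  have H: "?H \<in> carrier_mat (n + t) (n + t)" using G by simp
  have "?H ^\<^sub>m Suc s * chain_vec u t (q + Suc s) = ?H ^\<^sub>m s * (?H * chain_vec u t (Suc (q + s)))"
    using assoc_mult_mat[OF pow_carrier_mat[OF H] H chain_vec_carrier[OF u, of t "Suc (q + s)"]] by simp
  also have "?H * chain_vec u t (Suc (q + s)) = chain_vec u t (q + s)"
    using Suc.prems by (intro char_matrix_attach_jordan_mult_chain_vec[OF G u]) simp
  finally show ?case using Suc by simp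
qed

lemma chain_vec_append_rows:
  assumes u: "u \<in> carrier_mat n 1"
  shows "chain_vec u (t + s) t = chain_vec u t t @\<^sub>r 0\<^sub>m s 1"
  using u
  by (intro eq_matI) (auto simp: append_rows_def index_chain_vec[OF u] chain_vec_def)

lemma pow_mat_add:
  fixes A :: "'a :: semiring_1 mat"
  assumes A: "A \<in> carrier_mat n n"
  shows "A ^\<^sub>m (i + j) = A ^\<^sub>m i * A ^\<^sub>m j"
proof (induction j)
  case 0
  show ?case using A by simp
next
  case (Suc j)
  then show ?case
    using assoc_mult_mat[OF pow_carrier_mat[OF A] pow_carrier_mat[OF A] A, of i j] by simp
qed

text \<open>With y_q = (G - ev)^q v, subtract y_0, y_1, ..., y_(t-1) from the chain vectors of the
  block, starting at its far end. The new chain ends in u - y_t = 0 instead of \<open>u\<close>, so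
  it spans a separate Jordan block.\<close>

lemma attach_jordan_similar_diag:
  fixes G :: "'a :: field mat"
  assumes G: "G \<in> carrier_mat n n" and v: "v \<in> carrier_mat n 1"
    and u: "u = char_matrix G ev ^\<^sub>m t * v"
  shows "similar_mat (attach_jordan G u t ev)
    (four_block_mat G (0\<^sub>m n t) (0\<^sub>m t n) (jordan_block t ev))"
proof -
  let ?C = "char_matrix G ev"
  define y where "y q = ?C ^\<^sub>m q * v" for q
  \<comment> \<open>\<open>X\<close> solves the Sylvester equation \<open>G X + u e\<^sub>1\<^sup>T = X J\<close>, which decouples the two blocks.\<close>
  define X where "X = mat n t (\<lambda>(i, j). - (y (t - 1 - j) $$ (i, 0)))"
  have C: "?C \<in> carrier_mat n n" using G by simp
  have y: "y q \<in> carrier_mat n 1" for q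
    unfolding y_def using C v by (intro mult_carrier_mat pow_carrier_mat) auto
  have uc: "u \<in> carrier_mat n 1" using y[of t] by (simp add: u y_def)
  have X: "X \<in> carrier_mat n t" by (simp add: X_def)
  have Cy: "?C * y q = y (Suc q)" for q
  proof -
    have "?C ^\<^sub>m Suc q = ?C * ?C ^\<^sub>m q" using pow_mat_add[OF C, of 1 q] C by simp
    then show ?thesis unfolding y_def using C v
      by (simp add: assoc_mult_mat[OF C pow_carrier_mat[OF C] v])
  qed
  have Gy: "(\<Sum>l = 0..<n. G $$ (i, l) * y q $$ (l, 0)) = y (Suc q) $$ (i, 0) + ev * y q $$ (i, 0)"
    if i: "i < n" for i q
  proof -
    have "y (Suc q) $$ (i, 0) = (\<Sum>l = 0..<n. ?C $$ (i, l) * y q $$ (l, 0))"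
      unfolding Cy[symmetric] using i carrier_matD[OF C] carrier_matD[OF y[of q]]
      by (simp add: scalar_prod_def)
    also have "\<dots> = (\<Sum>l = 0..<n. G $$ (i, l) * y q $$ (l, 0) - (if l = i then ev * y q $$ (l, 0) else 0))"
      using i G by (intro sum.cong) (auto simp: char_matrix_def algebra_simps)
    also have "\<dots> = (\<Sum>l = 0..<n. G $$ (i, l) * y q $$ (l, 0)) - ev * y q $$ (i, 0)"
      using i by (simp add: sum_subtractf)
    finally show ?thesis by simp
  qed
  have eq: "G * X + u * first_row t = X * jordan_block t ev"
  proof (rule eq_matI)
    fix i j assume "i < dim_row (X * jordan_block t ev)" "j < dim_col (X * jordan_block t ev)"
    then have i: "i < n" and j: "j < t" using X by auto
    have "(G * X) $$ (i, j) = (\<Sum>l = 0..<n. G $$ (i, l) * (- y (t - 1 - j) $$ (l, 0)))"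
      using i j G by (simp add: X_def scalar_prod_def)
    also have "\<dots> = - (y (t - j) $$ (i, 0) + ev * y (t - 1 - j) $$ (i, 0))"
      using Gy[OF i, of "t - 1 - j"] j by (simp add: sum_negf Suc_diff_Suc)
    finally have 1: "(G * X) $$ (i, j) = - (y (t - j) $$ (i, 0) + ev * y (t - 1 - j) $$ (i, 0))" .
    have "(X * jordan_block t ev) $$ (i, j) = (\<Sum>l = 0..<t. X $$ (i, l) * jordan_block t ev $$ (l, j))"
      using i j X by (simp add: scalar_prod_def)
    also have "\<dots> = (\<Sum>l = 0..<t. (if l = j then ev * X $$ (i, l) else 0) +
        (if Suc l = j then X $$ (i, l) else 0))"
      using j by (intro sum.cong) (auto simp: mult.commute)
    also have "\<dots> = ev * X $$ (i, j) + (\<Sum>l = 0..<t. if Suc l = j then X $$ (i, l) else 0)"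
      using j by (simp add: sum.distrib)
    also have "(\<Sum>l = 0..<t. if Suc l = j then X $$ (i, l) else 0) =
        (if j = 0 then 0 else X $$ (i, j - 1))"
    proof (cases j)
      case (Suc j')
      then have "(\<Sum>l = 0..<t. if Suc l = j then X $$ (i, l) else 0) =
          (\<Sum>l = 0..<t. if l = j' then X $$ (i, l) else 0)" by (intro sum.cong) auto
      then show ?thesis using Suc j by simp
    qed simp
    finally have 2: "(X * jordan_block t ev) $$ (i, j) =
        ev * X $$ (i, j) + (if j = 0 then 0 else X $$ (i, j - 1))" .
    have 3: "(G * X + u * first_row t) $$ (i, j) =
        (G * X) $$ (i, j) + (u * first_row t) $$ (i, j)"
      using i j G X uc by (intro index_add_mat) (auto simp: first_row_def)
    show "(G * X + u * first_row t) $$ (i, j) = (X * jordan_block t ev) $$ (i, j)"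
      unfolding 1 2 3 index_mult_first_row[OF uc i j]
      using i j by (auto simp: X_def u y_def)
  qed (use G X uc in \<open>auto simp: first_row_def\<close>)
  let ?D = "four_block_mat G (0\<^sub>m n t) (0\<^sub>m t n) (jordan_block t ev)"
  let ?P = "four_block_mat (1\<^sub>m n) X (0\<^sub>m t n) (1\<^sub>m t)"
  let ?Q = "four_block_mat (1\<^sub>m n) (- X) (0\<^sub>m t n) (1\<^sub>m t)"
  have H: "attach_jordan G u t ev = four_block_mat G (u * first_row t) (0\<^sub>m t n) (jordan_block t ev)"
    using G by (simp add: attach_jordan_def)
  have ur: "u * first_row t \<in> carrier_mat n t" using mult_carrier_mat[OF uc first_row_carrier] .
  have PQ: "?P * ?Q = 1\<^sub>m (n + t)"
    using X by (subst mult_four_block_mat[of _ n n _ t _ t _ _ n _ t])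
      (auto simp flip: four_block_one_mat intro!: cong_four_block_mat)
  have QP: "?Q * ?P = 1\<^sub>m (n + t)"
    using X by (subst mult_four_block_mat[of _ n n _ t _ t _ _ n _ t])
      (auto simp flip: four_block_one_mat intro!: cong_four_block_mat)
  have HP: "attach_jordan G u t ev * ?P = four_block_mat G (G * X + u * first_row t) (0\<^sub>m t n) (jordan_block t ev)"
    unfolding H using X G ur right_mult_zero_mat[OF ur]
    by (subst mult_four_block_mat[of _ n n _ t _ t _ _ n _ t]) (auto intro!: cong_four_block_mat)
  have PD: "?P * ?D = four_block_mat G (X * jordan_block t ev) (0\<^sub>m t n) (jordan_block t ev)"
    using X G
    by (subst mult_four_block_mat[of _ n n _ t _ t _ _ n _ t]) (auto intro!: cong_four_block_mat)
  have Hc: "attach_jordan G u t ev \<in> carrier_mat (n + t) (n + t)" using G by simp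
  have Pc: "?P \<in> carrier_mat (n + t) (n + t)" "?Q \<in> carrier_mat (n + t) (n + t)"
    "?D \<in> carrier_mat (n + t) (n + t)"
    using G by (intro four_block_carrier_mat; simp)+
  have "?P * ?D * ?Q = attach_jordan G u t ev * (?P * ?Q)"
    unfolding PD eq[symmetric] HP[symmetric] using Hc Pc by (intro assoc_mult_mat) auto
  then have "attach_jordan G u t ev = ?P * ?D * ?Q" using Hc by (simp add: PQ)
  from similar_matI[OF _ PQ QP this] show ?thesis using Hc Pc by blast
qed

section \<open>Normal form of a single-input pair under feedback\<close>

definition brunovsky :: "(nat \<times> 'a :: comm_ring_1) list \<Rightarrow> nat \<Rightarrow> 'a mat" where
  "brunovsky cs d = four_block_mat (jordan_matrix cs) (0\<^sub>m (sum_list (map fst cs)) d)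
     (0\<^sub>m d (sum_list (map fst cs))) (jordan_block d 0)"

text \<open>For \<open>d = 0\<close> nothing is reachable, whereas the last unit vector would then
  point into the Jordan part; hence the zero input.\<close>

definition brunovsky_input :: "(nat \<times> 'a :: comm_ring_1) list \<Rightarrow> nat \<Rightarrow> 'a mat" where
  "brunovsky_input cs d = (let n = sum_list (map fst cs) + d in
     if d = 0 then 0\<^sub>m n 1 else last_unit n)"

lemma brunovsky_Suc:
  "brunovsky cs (Suc d) = four_block_mat (brunovsky cs d) (brunovsky_input cs d)
     (0\<^sub>m 1 (sum_list (map fst cs) + d)) (0\<^sub>m 1 1)"
  by (rule eq_matI) (auto simp: brunovsky_def brunovsky_input_def Let_def last_unit_def)

lemma brunovsky_Cons:
  "brunovsky ((k, ev) # cs) d = four_block_mat (jordan_block k ev)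
     (0\<^sub>m k (sum_list (map fst cs) + d)) (0\<^sub>m (sum_list (map fst cs) + d) k) (brunovsky cs d)"
  by (rule eq_matI) (auto simp: brunovsky_def jordan_matrix_Cons)

lemma brunovsky_input_Cons:
  "brunovsky_input ((k, ev) # cs) d = 0\<^sub>m k 1 @\<^sub>r brunovsky_input cs d"
  by (rule eq_matI) (auto simp: brunovsky_input_def Let_def last_unit_def append_rows_def)

text \<open>Seen from the end of its chain the whole attached block is reachable. Each row lengthens
  the controllable chain by one, and the eigenvalue on the diagonal is fed back.\<close>

lemma feedback_equiv_attach_boxes:
  assumes f: "feedback_equiv n G u (brunovsky cs d) (brunovsky_input cs d)"
    and n: "n = sum_list (map fst cs) + d"
  shows "feedback_equiv (n + t) (attach_jordan G u t ev) (chain_vec u t t)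
     (brunovsky cs (d + t)) (brunovsky_input cs (d + t))"
proof (induction t)
  case 0
  have "G \<in> carrier_mat n n" "u \<in> carrier_mat n 1" using f by (auto simp: feedback_equiv_def)
  then show ?case using f by (simp add: attach_jordan_0)
next
  case (Suc t)
  have G: "G \<in> carrier_mat n n" and u: "u \<in> carrier_mat n 1" using f by (auto simp: feedback_equiv_def)
  have "brunovsky_input cs (Suc (d + t)) = last_unit (n + t + 1)"
    by (simp add: brunovsky_input_def n add.assoc)
  then show ?case
    using feedback_equiv_box[OF Suc.IH, of "mat 1 1 (\<lambda>_. ev)"]
    by (simp add: attach_jordan_Suc[OF G u] chain_vec_Suc_self[OF u] brunovsky_Suc n add.assoc)
qed

text \<open>Only the last \<open>s\<close> rows of the attached block survive as a Jordan block of the normal form; the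
  first \<open>t - s\<close> of them are swallowed by the controllable part.\<close>

lemma feedback_equiv_attach_jordan:
  fixes G :: "'a :: comm_ring_1 mat"
  assumes f: "feedback_equiv n G u (brunovsky cs d) (brunovsky_input cs d)"
    and n: "n = sum_list (map fst cs) + d" and s: "s \<le> t"
  shows "feedback_equiv (n + t) (attach_jordan G u t ev) (chain_vec u t (t - s))
     (brunovsky ((s, ev) # cs) (d + (t - s))) (brunovsky_input ((s, ev) # cs) (d + (t - s)))"
proof -
  define q where "q = t - s"
  have t: "t = q + s" using s by (simp add: q_def)
  have G: "G \<in> carrier_mat n n" and u: "u \<in> carrier_mat n 1" using f by (auto simp: feedback_equiv_def)
  let ?H = "attach_jordan G u q ev" and ?z = "chain_vec u q q"
  let ?m = "n + q"
  \<comment> \<open>The lower \<open>s\<close> rows are moved to the front, where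
    \<open>feedback_equiv_block\<close> expects the unreached summand. Their coupling starts from
    the input \<open>?z\<close>, so feedback can cancel it.\<close>
  let ?N = "four_block_mat (jordan_block s ev) (0\<^sub>m s ?m) (?z * first_row s) ?H"
  let ?Q = "four_block_mat (0\<^sub>m s ?m) (1\<^sub>m s) (1\<^sub>m ?m) (0\<^sub>m ?m s)"
  have H: "?H \<in> carrier_mat ?m ?m" using G by simp
  have z: "?z \<in> carrier_mat ?m 1" using u by simp
  have zr: "?z * first_row s \<in> carrier_mat ?m s" using mult_carrier_mat[OF z first_row_carrier] .
  have sm: "s + ?m = n + t" by (simp add: t)
  have 1: "feedback_equiv (n + t) ?N (0\<^sub>m s 1 @\<^sub>r ?z)
     (brunovsky ((s, ev) # cs) (d + q)) (brunovsky_input ((s, ev) # cs) (d + q))"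
    using feedback_equiv_block[OF feedback_equiv_attach_boxes[OF f n, of q ev] jordan_block_carrier[of s ev] first_row_carrier]
    unfolding sm by (simp add: brunovsky_Cons brunovsky_input_Cons n add.assoc)
  have wit: "similar_mat_wit (attach_jordan G u t ev) ?N
      (four_block_mat (0\<^sub>m ?m s) (1\<^sub>m ?m) (1\<^sub>m s) (0\<^sub>m s ?m)) ?Q"
    unfolding t attach_jordan_four_block[OF G u]
    by (rule similar_mat_wit_swap_blocks[OF H zr zero_carrier_mat jordan_block_carrier])
  have Qz: "?Q * chain_vec u t q = 0\<^sub>m s 1 @\<^sub>r ?z"
    unfolding t chain_vec_append_rows[OF u] append_rows_def using z
    by (subst mult_four_block_mat[of _ s ?m _ s _ ?m _ _ 1 _ 0]) (auto intro!: cong_four_block_mat)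
  have "feedback_equiv (n + t) (attach_jordan G u t ev) (chain_vec u t q) ?N (?Q * chain_vec u t q)"
    using feedback_equiv_similar[OF wit] G u by simp
  from feedback_equiv_trans[OF this[unfolded Qz] 1]
  show ?thesis unfolding q_def .
qed

text \<open>This starts the chain of blocks for a new eigenvalue: the shifted matrix is invertible,
  so the splitting hypothesis of \<open>attach_jordan_similar_diag\<close> holds for any input left
  over from the other eigenvalues.\<close>

lemma char_matrix_pow_surj:
  fixes G :: "'a :: field mat"
  assumes G: "similar_mat G (jordan_matrix ts)" "G \<in> carrier_mat n n" and ev: "ev \<notin> snd ` set ts"
    and u: "u \<in> carrier_mat n 1"
  shows "\<exists>v \<in> carrier_mat n 1. u = char_matrix G ev ^\<^sub>m t * v"
proof -
  let ?C = "char_matrix G ev"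
  have C: "?C \<in> carrier_mat n n" using G by simp
  have cp: "char_poly G = (\<Prod>(n, a)\<leftarrow>ts. [:- a, 1:] ^ n)"
    using char_poly_similar[OF G(1)] by (simp add: jordan_matrix_char_poly)
  have "poly (\<Prod>(n, a)\<leftarrow>ts. [:- a, 1:] ^ n) ev \<noteq> 0"
    using ev by (induction ts) auto
  then have "\<not> eigenvalue G ev" using eigenvalue_root_char_poly[OF G(2)] cp by simp
  then have "det ?C \<noteq> 0" using eigenvalue_det[OF G(2)] by simp
  from det_non_zero_imp_unit[OF C this] obtain D where D: "D \<in> carrier_mat n n" "?C * D = 1\<^sub>m n"
    unfolding Units_def by (auto simp: ring_mat_def)
  show ?thesis
  proof (induction t)
    case 0
    show ?case using u C by (intro bexI[of _ u]) auto
  next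
    case (Suc t)
    then obtain v where v: "v \<in> carrier_mat n 1" "u = ?C ^\<^sub>m t * v" by blast
    have "?C ^\<^sub>m Suc t * (D * v) = ?C ^\<^sub>m t * (?C * (D * v))"
      using assoc_mult_mat[OF pow_carrier_mat[OF C] C, of "D * v" 1] D v by simp
    also have "?C * (D * v) = v" using assoc_mult_mat[OF C D(1) v(1)] D v by simp
    finally show ?case using v D by (intro bexI[of _ "D * v"]) auto
  qed
qed

section \<open>Jordan matrices and the Weyr characteristic\<close>

lemma jordan_matrix_append:
  "jordan_matrix (xs @ ys) = four_block_mat (jordan_matrix xs)
     (0\<^sub>m (sum_list (map fst xs)) (sum_list (map fst ys)))
     (0\<^sub>m (sum_list (map fst ys)) (sum_list (map fst xs))) (jordan_matrix ys)"
  by (subst jordan_matrix_def)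
    (simp only: map_append diag_block_mat_append Let_def jordan_matrix_def[symmetric] jordan_matrix_dim)

lemma similar_mat_jordan_matrix_dim:
  assumes "similar_mat A (jordan_matrix xs)" and "A \<in> carrier_mat n n"
  shows "sum_list (map fst xs) = n"
proof -
  obtain k P Q where "{A, jordan_matrix xs, P, Q} \<subseteq> carrier_mat k k"
    using similar_matD[OF assms(1)] by blast
  then have "A \<in> carrier_mat k k" "jordan_matrix xs \<in> carrier_mat k k" by auto
  then show ?thesis using assms(2) carrier_matD(1) by (metis jordan_matrix_dim(1))
qed

lemma similar_jordan_matrix_Cons:
  assumes "similar_mat (jordan_matrix xs) (jordan_matrix ys)"
  shows "similar_mat (jordan_matrix (x # xs)) (jordan_matrix (x # ys))"
proof -
  have "sum_list (map fst xs) = sum_list (map fst ys)"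
    using similar_mat_jordan_matrix_dim[OF assms jordan_matrix_carrier] by simp
  moreover obtain k a where "x = (k, a)" by force
  ultimately show ?thesis
    using similar_mat_four_block_0_0[OF similar_mat_refl[OF jordan_block_carrier] assms
        jordan_block_carrier jordan_matrix_carrier, of k a]
    by (simp add: jordan_matrix_Cons)
qed

lemma similar_jordan_matrix_perm:
  fixes xs ys :: "(nat \<times> 'a :: comm_ring_1) list"
  assumes "mset xs = mset ys"
  shows "similar_mat (jordan_matrix xs) (jordan_matrix ys)"
  using assms
proof (induction ys arbitrary: xs)
  case Nil
  then show ?case using similar_mat_refl[OF jordan_matrix_carrier] by auto
next
  case (Cons y ys)
  then have "y \<in> set xs" by (metis list.set_intros(1) mset_eq_setD)
  then obtain us vs where xs: "xs = us @ y # vs" by (meson split_list)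
  have "similar_mat (jordan_matrix xs) (jordan_matrix (y # vs @ us))"
    using similar_mat_swap_diag_blocks[OF jordan_matrix_carrier[of us] jordan_matrix_carrier[of "y # vs"]]
    unfolding xs append_Cons[of y vs us, symmetric] jordan_matrix_append[of us "y # vs"]
      jordan_matrix_append[of "y # vs" us] .
  moreover have "mset (vs @ us) = mset ys" using Cons.prems xs by (simp add: ac_simps)
  ultimately show ?case
    using similar_jordan_matrix_Cons[OF Cons.IH] similar_mat_trans by blast
qed

text \<open>\<open>jordan_nf\<close> demands positive sizes, while partitions padded with zeros to a
  common length produce blocks of size 0.\<close>

lemma jordan_matrix_filter_nonzero:
  "jordan_matrix (filter (\<lambda>(s, e). 0 < s) xs) = jordan_matrix xs"
proof (induction xs)
  case Nil
  show ?case by simp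
next
  case (Cons x xs)
  have [simp]: "sum_list (map fst (filter (\<lambda>(s, e). 0 < s) xs)) = sum_list (map fst xs)"
    using Cons by (metis jordan_matrix_dim(1))
  obtain s e where "x = (s, e)" by force
  then show ?case using Cons
    by (cases "s = 0") (auto simp: jordan_matrix_Cons intro!: eq_matI)
qed

definition blocks_ge :: "(nat \<times> 'a) list \<Rightarrow> nat \<Rightarrow> 'a \<Rightarrow> nat" where
  "blocks_ge xs m ev = length (filter (\<lambda>(s, e). e = ev \<and> m \<le> s) xs)"

lemma blocks_ge_simps [simp]:
  "blocks_ge [] m ev = 0"
  "blocks_ge ((s, e) # xs) m ev = (if e = ev \<and> m \<le> s then 1 else 0) + blocks_ge xs m ev"
  "blocks_ge (xs @ ys) m ev = blocks_ge xs m ev + blocks_ge ys m ev"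
  by (simp_all add: blocks_ge_def)

lemma blocks_ge_filter_nonzero:
  "m \<ge> 1 \<Longrightarrow> blocks_ge (filter (\<lambda>(s, e). 0 < s) xs) m ev = blocks_ge xs m ev"
  by (induction xs) auto

lemma blocks_ge_count:
  "blocks_ge xs s e = count (mset xs) (s, e) + blocks_ge xs (Suc s) e"
  by (induction xs) (auto simp: Suc_le_eq split: if_splits)

lemma weyr_similar_jordan_matrix:
  assumes "similar_mat A (jordan_matrix xs)" and "m \<ge> 1"
  shows "weyr A m ev = blocks_ge xs m ev"
proof -
  let ?ys = "filter (\<lambda>(s, e). 0 < s) xs"
  have "jordan_nf A ?ys"
    using assms(1) by (auto simp: jordan_nf_def jordan_matrix_filter_nonzero)
  from weyr_jordan_nf[OF this assms(2), of ev] show ?thesis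
    using blocks_ge_filter_nonzero[OF assms(2), of xs ev] by (simp add: blocks_ge_def)
qed

text \<open>The multiplicity of a block size is the drop between two consecutive Weyr numbers
  (\<open>blocks_ge_count\<close>), so these numbers fix the list of blocks up to order.\<close>

lemma similar_jordan_matrix_of_weyr:
  assumes A: "A \<in> carrier_mat n n" and w: "\<And>m ev. m \<ge> 1 \<Longrightarrow> weyr A m ev = blocks_ge xs m ev"
  shows "similar_mat A (jordan_matrix xs)"
proof -
  obtain ys where ys: "jordan_nf A ys" using complex_jordan_nf_exists[OF A] by blast
  let ?xs = "filter (\<lambda>(s, e). 0 < s) xs"
  have "mset ys = mset ?xs"
  proof (rule multiset_eqI)
    fix p :: "nat \<times> complex"
    obtain s e where p: "p = (s, e)" by force
    show "count (mset ys) p = count (mset ?xs) p"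
    \<comment> \<open>The hypothesis is silent at \<open>m = 0\<close>, so size 0 is settled by its
      absence from both lists.\<close>
    proof (cases "s = 0")
      case True
      then have "p \<notin> set ys" "p \<notin> set ?xs" using ys by (auto simp: jordan_nf_def p image_iff)
      then show ?thesis by (metis count_mset_0_iff)
    next
      case False
      have "blocks_ge ys m e = blocks_ge ?xs m e" if "m \<ge> 1" for m
        using weyr_jordan_nf[OF ys that, of e] w[OF that, of e] blocks_ge_filter_nonzero[OF that, of xs e]
        by (simp add: blocks_ge_def)
      from this[of s] this[of "Suc s"] False show ?thesis
        unfolding p using blocks_ge_count[of ys s e] blocks_ge_count[of ?xs s e] by simp
    qed
  qed
  from similar_jordan_matrix_perm[OF this] ys show ?thesis
    unfolding jordan_matrix_filter_nonzero jordan_nf_def using similar_mat_trans by blast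
qed

section \<open>Rank one perturbations\<close>

text \<open>The uncontrollable part of \<open>(G, u)\<close> has Jordan blocks \<open>cs\<close>. Two matrices of the same size that
  share \<open>cs\<close> are similar to matrices that differ by rank one. Blocks of size 0 are allowed in both
  lists.\<close>

definition rank_one_between ::
    "(nat \<times> 'a) list \<Rightarrow> (nat \<times> 'a :: field) list \<Rightarrow> 'a mat \<Rightarrow> 'a mat \<Rightarrow> bool" where
  "rank_one_between cs ts G u \<longleftrightarrow> similar_mat G (jordan_matrix ts) \<and>
     (\<exists>d. feedback_equiv (sum_list (map fst cs) + d) G u (brunovsky cs d) (brunovsky_input cs d))"

lemma rank_one_between_Nil: "rank_one_between [] [] (0\<^sub>m 0 0) (0\<^sub>m 0 1)"
proof -
  have "feedback_equiv 0 (0\<^sub>m 0 0) (0\<^sub>m 0 1) (brunovsky [] 0) (brunovsky_input [] 0)"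
    by (rule feedback_equivI[where P = "1\<^sub>m 0" and Q = "1\<^sub>m 0" and r = "0\<^sub>m 1 0"])
      (auto simp: brunovsky_def brunovsky_input_def intro!: eq_matI)
  moreover have "0\<^sub>m 0 0 = jordan_matrix []" by (rule eq_matI) auto
  ultimately show ?thesis
    using similar_mat_refl[OF jordan_matrix_carrier, of "[]"] unfolding rank_one_between_def
    by (metis add_0 list.map(1) sum_list.Nil)
qed

lemma rank_one_between_carrier:
  assumes "rank_one_between cs ts G u"
  shows "G \<in> carrier_mat (sum_list (map fst ts)) (sum_list (map fst ts))"
    and "u \<in> carrier_mat (sum_list (map fst ts)) 1"
proof -
  show G: "G \<in> carrier_mat (sum_list (map fst ts)) (sum_list (map fst ts))"
  proof -
    have s: "similar_mat G (jordan_matrix ts)" using assms by (simp add: rank_one_between_def)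
    then obtain k P Q where "{G, jordan_matrix ts, P, Q} \<subseteq> carrier_mat k k"
      using similar_matD by blast
    then have "G \<in> carrier_mat k k" by blast
    with similar_mat_jordan_matrix_dim[OF s this] show ?thesis by simp
  qed
  obtain n where "G \<in> carrier_mat n n" "u \<in> carrier_mat n 1"
    using assms unfolding rank_one_between_def feedback_equiv_def by blast
  then show "u \<in> carrier_mat (sum_list (map fst ts)) 1" using G by auto
qed

text \<open>Taking the chain vector with number \<open>t - s\<close> as new input leaves
  \<open>s\<close> rows of the block unreached. That vector is the image of the last chain vector
  under the \<open>s\<close>-th power of the shifted matrix, so the invariant on the input survives,
  with exponent \<open>s\<close> for the next block.\<close>

lemma rank_one_between_Cons:
  assumes r: "rank_one_between cs ts G u" and s: "s \<le> t"
    and n: "n = sum_list (map fst ts)" and v: "v \<in> carrier_mat n 1" "u = char_matrix G ev ^\<^sub>m t * v"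
  obtains G' u' v' where "rank_one_between ((s, ev) # cs) ((t, ev) # ts) G' u'"
    "v' \<in> carrier_mat (n + t) 1" "u' = char_matrix G' ev ^\<^sub>m s * v'"
proof
  let ?G = "attach_jordan G u t ev"
  have G: "G \<in> carrier_mat n n" and u: "u \<in> carrier_mat n 1"
    using rank_one_between_carrier[OF r] n by auto
  obtain d where d: "feedback_equiv (sum_list (map fst cs) + d) G u (brunovsky cs d) (brunovsky_input cs d)"
    using r unfolding rank_one_between_def by blast
  have nd: "n = sum_list (map fst cs) + d"
    using d G unfolding feedback_equiv_def by auto
  have f: "feedback_equiv (sum_list (map fst ((s, ev) # cs)) + (d + (t - s))) ?G (chain_vec u t (t - s))
     (brunovsky ((s, ev) # cs) (d + (t - s))) (brunovsky_input ((s, ev) # cs) (d + (t - s)))"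
    using feedback_equiv_attach_jordan[OF d refl s, of ev] s by (simp add: ac_simps)
  have "similar_mat ?G (four_block_mat G (0\<^sub>m n t) (0\<^sub>m t n) (jordan_block t ev))"
    using attach_jordan_similar_diag[OF G v] .
  moreover have "similar_mat (four_block_mat G (0\<^sub>m n t) (0\<^sub>m t n) (jordan_block t ev))
      (four_block_mat (jordan_block t ev) (0\<^sub>m t n) (0\<^sub>m n t) G)"
    by (rule similar_mat_swap_diag_blocks[OF G jordan_block_carrier])
  moreover have "similar_mat (four_block_mat (jordan_block t ev) (0\<^sub>m t n) (0\<^sub>m n t) G)
      (jordan_matrix ((t, ev) # ts))"
    unfolding jordan_matrix_Cons n[symmetric] using r G
    by (intro similar_mat_four_block_0_0 similar_mat_refl[of _ t]) (auto simp: rank_one_between_def)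
  ultimately have "similar_mat ?G (jordan_matrix ((t, ev) # ts))"
    using similar_mat_trans by blast
  then show "rank_one_between ((s, ev) # cs) ((t, ev) # ts) ?G (chain_vec u t (t - s))"
    using f unfolding rank_one_between_def by blast
  show "chain_vec u t t \<in> carrier_mat (n + t) 1" using u by simp
  show "chain_vec u t (t - s) = char_matrix ?G ev ^\<^sub>m s * chain_vec u t t"
    using char_matrix_attach_jordan_pow_mult_chain_vec[OF G u, of "t - s" s t ev] s by simp
qed

text \<open>The first inequality allows each block to be cut. The second makes an
  \<open>s i\<close>-th image also a \<open>t (Suc i)\<close>-th image, which is what the next block
  needs in order to split off.\<close>

lemma rank_one_between_interlacing_chain:
  fixes s t :: "nat \<Rightarrow> nat"
  assumes r: "rank_one_between cs ts G u" and ev: "ev \<notin> snd ` set ts"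
    and st: "\<And>i. s i \<le> t i" and ts: "\<And>i. t (Suc i) \<le> s i"
  shows "\<exists>G' u'. rank_one_between (map (\<lambda>i. (s i, ev)) (rev [0..<k]) @ cs)
           (map (\<lambda>i. (t i, ev)) (rev [0..<k]) @ ts) G' u'"
proof -
  let ?cs = "\<lambda>k. map (\<lambda>i. (s i, ev)) (rev [0..<k]) @ cs"
  let ?ts = "\<lambda>k. map (\<lambda>i. (t i, ev)) (rev [0..<k]) @ ts"
  \<comment> \<open>The exponent \<open>t k\<close> belongs to the block attached next. For
    \<open>k = 0\<close> invertibility of the shifted matrix provides the witness.\<close>
  have "\<exists>G' u'. rank_one_between (?cs k) (?ts k) G' u' \<and>
      (\<exists>v \<in> carrier_mat (sum_list (map fst (?ts k))) 1. u' = char_matrix G' ev ^\<^sub>m t k * v)"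
  proof (induction k)
    case 0
    show ?case
      using r char_matrix_pow_surj[OF _ rank_one_between_carrier(1)[OF r] ev
          rank_one_between_carrier(2)[OF r], of "t 0"]
      by (auto simp: rank_one_between_def)
  next
    case (Suc k)
    let ?n = "sum_list (map fst (?ts k))"
    from Suc obtain G u v where r: "rank_one_between (?cs k) (?ts k) G u"
      and v: "v \<in> carrier_mat ?n 1" "u = char_matrix G ev ^\<^sub>m t k * v" by blast
    obtain G' u' v' where r': "rank_one_between ((s k, ev) # ?cs k) ((t k, ev) # ?ts k) G' u'"
      and v': "v' \<in> carrier_mat (?n + t k) 1" "u' = char_matrix G' ev ^\<^sub>m s k * v'"
      by (rule rank_one_between_Cons[OF r st refl v])
    let ?C = "char_matrix G' ev"
    have C: "?C \<in> carrier_mat (?n + t k) (?n + t k)"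
      using rank_one_between_carrier(1)[OF r'] by (simp add: add.commute)
    have "u' = ?C ^\<^sub>m t (Suc k) * (?C ^\<^sub>m (s k - t (Suc k)) * v')"
      using v' ts[of k] pow_mat_add[OF C, of "t (Suc k)" "s k - t (Suc k)"]
        assoc_mult_mat[OF pow_carrier_mat[OF C] pow_carrier_mat[OF C] v'(1)] by simp
    moreover have "?C ^\<^sub>m (s k - t (Suc k)) * v' \<in> carrier_mat (?n + t k) 1"
      using mult_carrier_mat[OF pow_carrier_mat[OF C] v'(1)] .
    ultimately show ?case using r' by (auto simp: add.commute)
  qed
  then show ?thesis by blast
qed

text \<open>Within one eigenvalue the indices run downwards because the construction conses each new,
  smaller block.\<close>

definition blocks_of :: "nat \<Rightarrow> ('a \<Rightarrow> nat \<Rightarrow> nat) \<Rightarrow> 'a list \<Rightarrow> (nat \<times> 'a) list" where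
  "blocks_of k p es = concat (map (\<lambda>e. map (\<lambda>i. (p e i, e)) (rev [0..<k])) es)"

lemma rank_one_between_interlacing:
  assumes "distinct es" and "\<And>e i. s e i \<le> t e i" and "\<And>e i. t e (Suc i) \<le> s e i"
  shows "\<exists>G u. rank_one_between (blocks_of k s es) (blocks_of k t es) G u"
  using assms(1)
proof (induction es)
  case Nil
  show ?case using rank_one_between_Nil by (auto simp: blocks_of_def)
next
  case (Cons e es)
  then obtain G u where r: "rank_one_between (blocks_of k s es) (blocks_of k t es) G u" by auto
  have "e \<notin> snd ` set (blocks_of k t es)" using Cons.prems by (auto simp: blocks_of_def)
  from rank_one_between_interlacing_chain[where s = "s e" and t = "t e", OF r this assms(2,3), of k]
  show ?case by (simp add: blocks_of_def)
qed

lemma feedback_equiv_similar_rank_one_update: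
  fixes G :: "'a :: comm_ring_1 mat"
  assumes "feedback_equiv n G u M w"
  shows "\<exists>r \<in> carrier_mat 1 n. similar_mat G (M + w * r)"
proof -
  from assms obtain P Q r where
    G: "G \<in> carrier_mat n n" and M: "M \<in> carrier_mat n n"
    and w: "w \<in> carrier_mat n 1" and P: "P \<in> carrier_mat n n" and Q: "Q \<in> carrier_mat n n"
    and r: "r \<in> carrier_mat 1 n" and 1: "P * Q = 1\<^sub>m n" "Q * P = 1\<^sub>m n" "P * G = M * P + w * r"
    by (rule feedback_equivE)
  have wr: "w * r \<in> carrier_mat n n" "w * (r * Q) \<in> carrier_mat n n"
    using mult_carrier_mat[OF w] r Q by auto
  have "(P * G) * Q = M * P * Q + w * r * Q"
    unfolding 1 using M P Q wr by (intro add_mult_distrib_mat[of _ n n]) auto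
  also have "M * P * Q = M" using M P Q 1 by simp
  also have "w * r * Q = w * (r * Q)" using w r Q by (rule assoc_mult_mat)
  finally have PGQ: "P * G * Q = M + w * (r * Q)" .
  have "Q * (P * G * Q) * P = Q * (P * G * Q * P)"
    using P G Q by (intro assoc_mult_mat[of _ n n _ n _ n]) auto
  also have "P * G * Q * P = P * G * (Q * P)" 
    using P G Q by (intro assoc_mult_mat[of _ n n _ n _ n]) auto
  also have "\<dots> = P * G"
    unfolding 1(2) by (rule right_mult_one_mat[OF mult_carrier_mat[OF P G]])
  also have "Q * (P * G) = (Q * P) * G" using P G Q by (intro assoc_mult_mat[symmetric]) auto
  also have "\<dots> = G" using G 1 by simp
  finally have "G = Q * (M + w * (r * Q)) * P" unfolding PGQ by simp
  then have "similar_mat G (M + w * (r * Q))"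
    using 1 G M wr P Q by (intro similar_matI[of _ _ Q P n]) auto
  then show ?thesis using r Q by (intro bexI[of _ "r * Q"]) auto
qed

lemma (in vec_space) rank_col_row_product:
  assumes "x \<in> carrier_mat n 1" "y \<in> carrier_mat 1 m"
  shows "rank (x * y) \<le> 1"
  using assms
  by (intro rank_le_1_product_entries[where f = "\<lambda>r. x $$ (r, 0)" and g = "\<lambda>c. y $$ (0, c)"])
    (auto simp: scalar_prod_def)

lemma rank_one_update_of_rank_one_between:
  fixes A :: "'a :: field mat"
  assumes A: "A \<in> carrier_mat n n" "similar_mat A (jordan_matrix ts)"
    and r: "rank_one_between cs ts G u" "rank_one_between cs ts' G' u'"
    and ts': "sum_list (map fst ts') = n"
  shows "\<exists>R \<in> carrier_mat n n. vec_space.rank n R \<le> 1 \<and> similar_mat (A + R) (jordan_matrix ts')"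
proof -
  have ts: "sum_list (map fst ts) = n"
    using similar_mat_jordan_matrix_dim[OF A(2,1)] .
  have G: "G \<in> carrier_mat n n" "similar_mat G (jordan_matrix ts)"
    and G': "G' \<in> carrier_mat n n" "similar_mat G' (jordan_matrix ts')"
    using r rank_one_between_carrier(1)[OF r(1)] rank_one_between_carrier(1)[OF r(2)] ts ts'
    by (auto simp: rank_one_between_def)
  obtain d d' where d: "feedback_equiv (sum_list (map fst cs) + d) G u (brunovsky cs d) (brunovsky_input cs d)"
    and d': "feedback_equiv (sum_list (map fst cs) + d') G' u' (brunovsky cs d') (brunovsky_input cs d')"
    using r unfolding rank_one_between_def by blast
  have n: "sum_list (map fst cs) + d = n" "sum_list (map fst cs) + d' = n"
    using d d' G G' unfolding feedback_equiv_def by auto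
  \<comment> \<open>Equal sizes and equal \<open>cs\<close> force controllable chains of equal
    length, so both pairs reduce to literally the same normal form.\<close>
  then have "d' = d" by simp
  let ?M = "brunovsky cs d" and ?w = "brunovsky_input cs d"
  have f: "feedback_equiv n G u ?M ?w" "feedback_equiv n G' u' ?M ?w"
    using d d' n unfolding \<open>d' = d\<close> by auto
  then have M: "?M \<in> carrier_mat n n" and w: "?w \<in> carrier_mat n 1" by (auto simp: feedback_equiv_def)
  obtain a b where a: "a \<in> carrier_mat 1 n" "similar_mat G (?M + ?w * a)"
    and b: "b \<in> carrier_mat 1 n" "similar_mat G' (?M + ?w * b)"
    using feedback_equiv_similar_rank_one_update[OF f(1)]
      feedback_equiv_similar_rank_one_update[OF f(2)] by blast
  have ba: "b - a \<in> carrier_mat 1 n" using a by (intro minus_carrier_mat)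
  have wa: "?w * a \<in> carrier_mat n n" "?w * b \<in> carrier_mat n n" "?w * (b - a) \<in> carrier_mat n n"
    by (rule mult_carrier_mat[OF w a(1)] mult_carrier_mat[OF w b(1)] mult_carrier_mat[OF w ba])+
  have "similar_mat A (?M + ?w * a)"
    using A(2) G(2) a(2) similar_mat_trans similar_mat_sym by blast
  then obtain P Q where wit: "similar_mat_wit A (?M + ?w * a) P Q" unfolding similar_mat_def by blast
  note PQ = similar_mat_witD2[OF A(1) wit]
  \<comment> \<open>The exchange of the feedback row \<open>a\<close> for \<open>b\<close>, carried
    back to the coordinates of \<open>A\<close>.\<close>
  let ?R = "P * (?w * (b - a)) * Q"
  have R: "?R \<in> carrier_mat n n" by (rule mult_carrier_mat[OF mult_carrier_mat[OF PQ(6) wa(3)] PQ(7)])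
  have "?w * b = ?w * a + ?w * (b - a)"
  proof -
    have "b = a + (b - a)" using a b by (intro eq_matI) auto
    then have "?w * b = ?w * (a + (b - a))" by simp
    also have "\<dots> = ?w * a + ?w * (b - a)"
      by (rule mult_add_distrib_mat[OF w a(1) ba])
    finally show ?thesis .
  qed
  then have "?M + ?w * b = (?M + ?w * a) + ?w * (b - a)"
    using M wa by simp
  then have "P * (?M + ?w * b) * Q = (P * (?M + ?w * a) + P * (?w * (b - a))) * Q"
    using mult_add_distrib_mat[OF PQ(6,5) wa(3)] by simp
  also have "\<dots> = P * (?M + ?w * a) * Q + ?R"
    by (rule add_mult_distrib_mat[OF mult_carrier_mat[OF PQ(6,5)] mult_carrier_mat[OF PQ(6) wa(3)] PQ(7)])
  finally have AR: "A + ?R = P * (?M + ?w * b) * Q" by (simp only: PQ(3)[symmetric])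
  have "{A + ?R, ?M + ?w * b, P, Q} \<subseteq> carrier_mat n n"
    using add_carrier_mat[OF R, of A] add_carrier_mat[OF wa(2), of ?M] PQ(6,7) by blast
  from similar_matI[OF this PQ(1,2) AR] have "similar_mat (A + ?R) (?M + ?w * b)" .
  then have sim: "similar_mat (A + ?R) (jordan_matrix ts')"
    using b(2) G'(2) similar_mat_trans similar_mat_sym by blast
  have Pw: "P * ?w \<in> carrier_mat n 1" "(b - a) * Q \<in> carrier_mat 1 n"
    using mult_carrier_mat[OF PQ(6) w] mult_carrier_mat[OF ba PQ(7)] .
  have "?R = (P * ?w) * ((b - a) * Q)"
  proof -
    have "P * (?w * (b - a)) = P * ?w * (b - a)"
      by (rule assoc_mult_mat[symmetric, OF PQ(6) w ba])
    then show ?thesis using assoc_mult_mat[OF Pw(1) ba PQ(7)] by simp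
  qed
  then have "vec_space.rank n ?R \<le> 1"
    using vec_space.rank_col_row_product[OF Pw] by simp
  with sim R show ?thesis by blast
qed

section \<open>Weyr characteristics as families of partitions\<close>

text \<open>The conjugate partition with parts numbered from 0: it turns Weyr numbers into Jordan
  block sizes in decreasing order.\<close>

definition conjugate_part :: "(nat \<Rightarrow> nat) \<Rightarrow> nat \<Rightarrow> nat" where
  "conjugate_part f i = card {m. 1 \<le> m \<and> i < f m}"

text \<open>\<open>E\<close> and \<open>N\<close> are a common finite window for all functions involved; the value at the index
  \<open>m = 0\<close> is irrelevant throughout.\<close>

definition weyr_profile :: "nat \<Rightarrow> 'a set \<Rightarrow> (nat \<Rightarrow> 'a \<Rightarrow> nat) \<Rightarrow> bool" where
  "weyr_profile N E b \<longleftrightarrow> (\<forall>m \<ge> 1. \<forall>e. b (Suc m) e \<le> b m e \<and> b m e \<le> N \<and>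
     (b m e \<noteq> 0 \<longrightarrow> e \<in> E \<and> m \<le> N))"

definition profile_total :: "nat \<Rightarrow> 'a set \<Rightarrow> (nat \<Rightarrow> 'a \<Rightarrow> nat) \<Rightarrow> nat" where
  "profile_total N E b = (\<Sum>(e, m)\<in>E \<times> {1..N}. b m e)"

lemma weyr_profileD:
  assumes "weyr_profile N E b" and "1 \<le> m"
  shows "b (Suc m) e \<le> b m e" "b m e \<le> N" "b m e \<noteq> 0 \<Longrightarrow> e \<in> E" "b m e \<noteq> 0 \<Longrightarrow> m \<le> N"
  using assms unfolding weyr_profile_def by blast+

lemma weyr_profile_cong:
  assumes "\<And>m e. m \<ge> 1 \<Longrightarrow> b m e = c m e"
  shows "weyr_profile N E b \<longleftrightarrow> weyr_profile N E c"
  using assms by (simp add: weyr_profile_def)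

lemma profile_total_cong:
  assumes "\<And>m e. m \<ge> 1 \<Longrightarrow> b m e = c m e"
  shows "profile_total N E b = profile_total N E c"
  unfolding profile_total_def using assms by (intro sum.cong) auto

lemma weyr_profile_antimono:
  assumes "weyr_profile N E b" "1 \<le> m" "m \<le> m'"
  shows "b m' e \<le> b m e"
  using assms(3)
proof (induction m' rule: dec_induct)
  case (step m')
  then have "b (Suc m') e \<le> b m' e" using assms(1,2) by (intro weyr_profileD(1)) auto
  then show ?case using step by simp
qed simp

lemma conjugate_part_set:
  assumes "weyr_profile N E b"
  shows "{m. 1 \<le> m \<and> i < b m e} \<subseteq> {1..N}"
proof safe
  fix m assume "1 \<le> m" "i < b m e"
  then show "m \<in> {1..N}" using weyr_profileD(4)[OF assms, of m e] by simp
qed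

text \<open>As \<open>b\<close> decreases in \<open>m\<close>, the set counted by
  \<open>conjugate_part\<close> is an initial segment of the positive integers, so comparing with
  its cardinality is testing membership.\<close>

lemma le_conjugate_part_iff:
  assumes b: "weyr_profile N E b" and m: "1 \<le> m"
  shows "m \<le> conjugate_part (\<lambda>m. b m e) i \<longleftrightarrow> i < b m e"
proof
  let ?S = "{m. 1 \<le> m \<and> i < b m e}"
  have fin: "finite ?S" by (rule finite_subset[OF conjugate_part_set[OF b]]) simp
  show "m \<le> conjugate_part (\<lambda>m. b m e) i" if "i < b m e"
  proof -
    have "{1..m} \<subseteq> ?S" using weyr_profile_antimono[OF b, of _ m e] that
      by (auto intro: less_le_trans)
    from card_mono[OF fin this] show ?thesis by (simp add: conjugate_part_def)
  qed
  show "i < b m e" if "m \<le> conjugate_part (\<lambda>m. b m e) i"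
  proof (rule ccontr)
    assume "\<not> i < b m e"
    then have "?S \<subseteq> {1..<m}" using weyr_profile_antimono[OF b m, of _ e]
      by (auto simp: not_less) (meson le_less_trans not_le)
    from card_mono[OF _ this] have "card ?S \<le> m - 1" by simp
    with that m show False by (simp add: conjugate_part_def)
  qed
qed

lemma blocks_ge_blocks_of:
  assumes "distinct es"
  shows "blocks_ge (blocks_of k p es) m e = (if e \<in> set es then card {i. i < k \<and> m \<le> p e i} else 0)"
  using assms
proof (induction es)
  case Nil
  show ?case by (simp add: blocks_of_def)
next
  case (Cons e' es)
  have *: "blocks_ge (map (\<lambda>i. (p e' i, e')) (rev [0..<k])) m e =
      (if e = e' then card {i. i < k \<and> m \<le> p e i} else 0)"
  proof -
    have "{i. i < Suc j \<and> m \<le> p e i} = {i. i < j \<and> m \<le> p e i} \<union> (if m \<le> p e j then {j} else {})" for j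
      by (auto simp: less_Suc_eq)
    then show ?thesis by (induction k) auto
  qed
  show ?case using Cons by (auto simp: blocks_of_def *)
qed

lemma sum_list_blocks_of:
  assumes "distinct es"
  shows "sum_list (map fst (blocks_of k p es)) = (\<Sum>e\<in>set es. \<Sum>i<k. p e i)"
proof -
  have *: "sum_list (map fst (map (\<lambda>i. (p e i, e)) (rev [0..<k]))) = (\<Sum>i<k. p e i)" for e
    by (induction k) auto
  show ?thesis using assms by (induction es) (auto simp: blocks_of_def * simp del: map_map)
qed

lemma blocks_ge_conjugate_part:
  assumes b: "weyr_profile N (set es) b" and es: "distinct es" and m: "1 \<le> m"
  shows "blocks_ge (blocks_of N (\<lambda>e. conjugate_part (\<lambda>m. b m e)) es) m e = b m e"
proof -
  have "b m e \<le> N" and "e \<notin> set es \<Longrightarrow> b m e = 0"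
    using weyr_profileD(2,3)[OF b m, of e] by blast+
  moreover from this have "{i. i < N \<and> i < b m e} = {..<b m e}" by auto
  ultimately show ?thesis
    unfolding blocks_ge_blocks_of[OF es] le_conjugate_part_iff[OF b m] by simp
qed

text \<open>The cells of each Young diagram are counted by rows and by columns; the bound
  \<open>N\<close> on the values ensures that no part is lost beyond index \<open>N\<close>.\<close>

lemma sum_list_conjugate_part:
  assumes b: "weyr_profile N (set es) b" and es: "distinct es"
  shows "sum_list (map fst (blocks_of N (\<lambda>e. conjugate_part (\<lambda>m. b m e)) es)) =
    profile_total N (set es) b"
proof -
  have "(\<Sum>i<N. conjugate_part (\<lambda>m. b m e) i) = (\<Sum>m=1..N. b m e)" for e
  proof -
    have "conjugate_part (\<lambda>m. b m e) i = (\<Sum>m=1..N. if i < b m e then 1 else 0)" for i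
    proof -
      have "{m. 1 \<le> m \<and> i < b m e} = {m \<in> {1..N}. i < b m e}"
        using conjugate_part_set[OF b, of i e] by auto
      then show ?thesis unfolding conjugate_part_def by (simp add: sum.If_cases Int_def)
    qed
    then have "(\<Sum>i<N. conjugate_part (\<lambda>m. b m e) i) = (\<Sum>m=1..N. \<Sum>i<N. if i < b m e then 1 else 0)"
      by (simp only: sum.swap[of _ "{1..N}"])
    also have "\<dots> = (\<Sum>m=1..N. b m e)"
    proof (rule sum.cong[OF refl])
      fix m assume "m \<in> {1..N}"
      then have "b m e \<le> N" using weyr_profileD(2)[OF b] by simp
      then have "{i. i < N \<and> i < b m e} = {..<b m e}" by auto
      then show "(\<Sum>i<N. if i < b m e then 1 else 0) = b m e"
        by (simp add: sum.If_cases Int_def)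
    qed
    finally show ?thesis .
  qed
  then show ?thesis
    unfolding sum_list_blocks_of[OF es] profile_total_def by (simp add: sum.cartesian_product)
qed

text \<open>Every larger window is allowed as well, because one window must later serve both the
  given matrix and the prescribed function.\<close>

lemma weyr_profile_weyr:
  assumes A: "A \<in> carrier_mat n n"
  obtains E0 where "finite E0" "\<And>N E. n \<le> N \<Longrightarrow> E0 \<subseteq> E \<Longrightarrow> weyr_profile N E (weyr A)"
proof -
  obtain ys where ys: "jordan_nf A ys" using complex_jordan_nf_exists[OF A] by blast
  then have sim: "similar_mat A (jordan_matrix ys)" and pos: "0 \<notin> fst ` set ys"
    by (auto simp: jordan_nf_def)
  have n: "sum_list (map fst ys) = n" by (rule similar_mat_jordan_matrix_dim[OF sim A])
  have w: "weyr A m e = blocks_ge ys m e" if "m \<ge> 1" for m e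
    by (rule weyr_similar_jordan_matrix[OF sim that])
  have len: "length ys \<le> sum_list (map fst ys)" using pos by (induction ys) (auto simp: Suc_le_eq)
  have mono: "blocks_ge ys (Suc m) e \<le> blocks_ge ys m e" for m e by (induction ys) auto
  have le: "blocks_ge ys m e \<le> n" for m e
    unfolding blocks_ge_def using len n by (meson le_trans length_filter_le order_refl)
  have nz: "e \<in> snd ` set ys \<and> m \<le> n" if nz: "blocks_ge ys m e \<noteq> 0" for m e
  proof -
    from nz obtain s where s: "(s, e) \<in> set ys" "m \<le> s"
      by (auto simp: blocks_ge_def filter_empty_conv)
    then have "s \<in> set (map fst ys)" by force
    then have "s \<le> n" unfolding n[symmetric] by (intro member_le_sum_list) auto
    then show ?thesis using s by force
  qed
  have "weyr_profile N E (weyr A)" if N: "n \<le> N" and E: "snd ` set ys \<subseteq> E" for N E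
  proof -
    have "weyr_profile N E (blocks_ge ys)"
      unfolding weyr_profile_def
    proof (intro allI impI conjI)
      fix m e
      show "blocks_ge ys (Suc m) e \<le> blocks_ge ys m e" by (rule mono)
      show "blocks_ge ys m e \<le> N" using le N by (rule le_trans)
      assume "blocks_ge ys m e \<noteq> 0"
      from nz[OF this] show "e \<in> E" "m \<le> N" using N E by auto
    qed
    then show ?thesis using weyr_profile_cong[of "weyr A" "blocks_ge ys", OF w] by simp
  qed
  then show thesis using that[of "snd ` set ys"] by simp
qed

text \<open>The conjugate parts of the characteristic form a block list for \<open>A\<close> itself,
  so its sizes add up to the dimension.\<close>

lemma profile_total_weyr:
  assumes A: "A \<in> carrier_mat n n" and p: "weyr_profile N E (weyr A)" and E: "finite E"
  shows "profile_total N E (weyr A) = n"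
proof -
  obtain es where es: "set es = E" "distinct es" using finite_distinct_list[OF E] by blast
  let ?xs = "blocks_of N (\<lambda>e. conjugate_part (\<lambda>m. weyr A m e)) es"
  have "similar_mat A (jordan_matrix ?xs)"
    using blocks_ge_conjugate_part[of N es "weyr A"] p es by (intro similar_jordan_matrix_of_weyr[OF A]) simp
  from similar_mat_jordan_matrix_dim[OF this A] show ?thesis
    using sum_list_conjugate_part[of N es "weyr A"] p es by simp
qed

lemma weyr_rank_one_perturbation:
  assumes A: "A \<in> carrier_mat n n" and a: "weyr_profile N E (weyr A)"
    and b: "weyr_profile N E b" and E: "finite E" and tot: "profile_total N E b = n"
    and close: "\<And>m e. m \<ge> 1 \<Longrightarrow> \<bar>int (weyr A m e) - int (b m e)\<bar> \<le> 1"
  shows "\<exists>R \<in> carrier_mat n n. vec_space.rank n R \<le> 1 \<and> (\<forall>m \<ge> 1. \<forall>e. weyr (A + R) m e = b m e)"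
proof -
  obtain es where es: "set es = E" "distinct es" using finite_distinct_list[OF E] by blast
  \<comment> \<open>The blocks of the common unreachable part. Since the two characteristics differ
    by at most 1, each lies between \<open>?c\<close> and \<open>Suc ?c\<close>.\<close>
  let ?c = "\<lambda>m e. min (weyr A m e) (b m e)"
  have c: "weyr_profile N E ?c"
    unfolding weyr_profile_def
  proof (intro allI impI conjI)
    fix m e assume m: "(1::nat) \<le> m"
    note a' = weyr_profileD[OF a m, of e] and b' = weyr_profileD[OF b m, of e]
    show "?c (Suc m) e \<le> ?c m e" "?c m e \<le> N" using a' b' by auto
    assume "?c m e \<noteq> 0"
    then show "e \<in> E" "m \<le> N" using a' by auto
  qed
  define part where "part f e = conjugate_part (\<lambda>m. f m e)" for f :: "nat \<Rightarrow> complex \<Rightarrow> nat" and e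
  have mono: "part f e i \<le> part g e j"
    if f: "weyr_profile N E f" and g: "weyr_profile N E g"
      and fg: "\<And>m. m \<ge> 1 \<Longrightarrow> i < f m e \<Longrightarrow> j < g m e" for f g e i j
    unfolding part_def conjugate_part_def
    using fg by (intro card_mono finite_subset[OF conjugate_part_set[OF g]]) auto
  \<comment> \<open>Under conjugation \<open>?c <= f\<close> becomes s_i <= t_i, and
    \<open>f <= Suc ?c\<close> becomes t_(i+1) <= s_i: raising all counts by one shifts the block
    index by one.\<close>
  have between: "\<exists>G u. rank_one_between (blocks_of N (part ?c) es) (blocks_of N (part f) es) G u"
    if f: "weyr_profile N E f"
      and cf: "\<And>m e. m \<ge> 1 \<Longrightarrow> ?c m e \<le> f m e" "\<And>m e. m \<ge> 1 \<Longrightarrow> f m e \<le> Suc (?c m e)" for f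
  proof (rule rank_one_between_interlacing[OF es(2)])
    show "part ?c e i \<le> part f e i" for e i
      by (rule mono[OF c f]) (metis cf(1) less_le_trans)
    show "part f e (Suc i) \<le> part ?c e i" for e i
      by (rule mono[OF f c]) (meson cf(2) Suc_less_eq less_le_trans)
  qed
  have d: "weyr A m e \<le> Suc (b m e) \<and> b m e \<le> Suc (weyr A m e)" if "m \<ge> 1" for m e
    using close[OF that, of e] by linarith
  have "\<exists>G u. rank_one_between (blocks_of N (part ?c) es) (blocks_of N (part (weyr A)) es) G u"
    by (rule between[OF a]) (use d in \<open>auto simp: min_def\<close>)
  then obtain G u where G: "rank_one_between (blocks_of N (part ?c) es) (blocks_of N (part (weyr A)) es) G u"
    by blast
  have "\<exists>G u. rank_one_between (blocks_of N (part ?c) es) (blocks_of N (part b) es) G u"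
    by (rule between[OF b]) (use d in \<open>auto simp: min_def\<close>)
  then obtain G' u' where G': "rank_one_between (blocks_of N (part ?c) es) (blocks_of N (part b) es) G' u'"
    by blast
  have A': "similar_mat A (jordan_matrix (blocks_of N (part (weyr A)) es))"
    using blocks_ge_conjugate_part[of N es "weyr A"] a es unfolding part_def
    by (intro similar_jordan_matrix_of_weyr[OF A]) simp
  have b': "sum_list (map fst (blocks_of N (part b) es)) = n"
    using sum_list_conjugate_part[of N es b] b es tot unfolding part_def by simp
  obtain R where R: "R \<in> carrier_mat n n" "vec_space.rank n R \<le> 1"
      "similar_mat (A + R) (jordan_matrix (blocks_of N (part b) es))"
    using rank_one_update_of_rank_one_between[OF A A' G G' b'] by blast
  have "weyr (A + R) m e = b m e" if "m \<ge> 1" for m e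
    using weyr_similar_jordan_matrix[OF R(3) that] blocks_ge_conjugate_part[of N es b m e] b es that
    unfolding part_def by simp
  with R show ?thesis by blast
qed

section \<open>Interpolation between two characteristics with the same total\<close>

lemma weyr_profile_decrement:
  assumes L: "weyr_profile N E L" and U: "weyr_profile N E U" and E: "finite E"
    and LU: "\<And>m e. m \<ge> 1 \<Longrightarrow> L m e \<le> U m e" and less: "profile_total N E L < profile_total N E U"
  obtains V where "weyr_profile N E V" "\<And>m e. m \<ge> 1 \<Longrightarrow> L m e \<le> V m e"
    "\<And>m e. m \<ge> 1 \<Longrightarrow> V m e \<le> U m e" "profile_total N E U = Suc (profile_total N E V)"
proof -
  have "\<exists>(e, m) \<in> E \<times> {1..N}. L m e < U m e"
  proof (rule ccontr)
    assume "\<not> ?thesis"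
    then have "profile_total N E U \<le> profile_total N E L"
      unfolding profile_total_def by (intro sum_mono) (auto simp: not_less)
    then show False using less by simp
  qed
  then obtain e m0 where e: "e \<in> E" "m0 \<in> {1..N}" "L m0 e < U m0 e" by auto
  define M where "M = {m \<in> {1..N}. L m e < U m e}"
  \<comment> \<open>At the last place where \<open>L\<close> and \<open>U\<close> differ, lowering \<open>U\<close> by one keeps it decreasing.\<close>
  define m where "m = Max M"
  have M: "finite M" "M \<noteq> {}" using e by (auto simp: M_def)
  have "m \<in> M" using Max_in[OF M] by (simp add: m_def)
  then have m: "1 \<le> m" "m \<le> N" "L m e < U m e" by (auto simp: M_def)
  have max: "U (Suc m) e = L (Suc m) e"
  proof (cases "Suc m \<le> N")
    case True
    have "Suc m \<notin> M" using Max_ge[OF M(1), of "Suc m"] by (auto simp: m_def)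
    then show ?thesis using True LU[of "Suc m" e] by (auto simp: M_def)
  next
    case False
    then show ?thesis using U L by (metis le_SucI m(1) weyr_profileD(4))
  qed
  define V where "V = U(m := (U m)(e := U m e - 1))"
  have Ve: "V m' e' = (if m' = m \<and> e' = e then U m e - 1 else U m' e')" for m' e'
    by (auto simp: V_def)
  have "L (Suc m) e \<le> L m e" by (rule weyr_profileD(1)[OF L m(1)])
  then have V: "U (Suc m) e \<le> U m e - 1" using max m(3) by simp
  have "weyr_profile N E V"
    unfolding weyr_profile_def
  proof (intro allI impI conjI)
    fix m' e' assume m': "(1::nat) \<le> m'"
    note U' = weyr_profileD[OF U m', of e']
    show "V (Suc m') e' \<le> V m' e'" "V m' e' \<le> N" using U' V by (auto simp: Ve)
    assume "V m' e' \<noteq> 0"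
    then have "U m' e' \<noteq> 0" by (auto simp: Ve split: if_splits)
    then show "e' \<in> E" "m' \<le> N" using U' by auto
  qed
  moreover have "L m' e' \<le> V m' e'" "V m' e' \<le> U m' e'" if "m' \<ge> 1" for m' e'
    using LU[OF that, of e'] m by (auto simp: Ve)
  moreover have "profile_total N E U = Suc (profile_total N E V)"
  proof -
    have p: "(e, m) \<in> E \<times> {1..N}" "finite (E \<times> {1..N})" using e m E by auto
    have "(\<Sum>x\<in>E \<times> {1..N} - {(e, m)}. case x of (e, m) \<Rightarrow> V m e) =
        (\<Sum>x\<in>E \<times> {1..N} - {(e, m)}. case x of (e, m) \<Rightarrow> U m e)"
      by (intro sum.cong) (auto simp: Ve split: if_splits)
    moreover have "V m e = U m e - 1" by (simp add: Ve)
    ultimately show ?thesis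
      unfolding profile_total_def sum.remove[OF p(2,1)] using m(3) by simp
  qed
  ultimately show thesis by (rule that)
qed

text \<open>A discrete intermediate value argument: removing one unit at a time from
  \<open>U\<close> passes through every total down to that of \<open>L\<close>.\<close>

lemma weyr_profile_between_exists:
  assumes L: "weyr_profile N E L" and U: "weyr_profile N E U" and E: "finite E"
    and LU: "\<And>m e. m \<ge> 1 \<Longrightarrow> L m e \<le> U m e"
    and T: "profile_total N E L \<le> T" "T \<le> profile_total N E U"
  obtains V where "weyr_profile N E V" "\<And>m e. m \<ge> 1 \<Longrightarrow> L m e \<le> V m e"
    "\<And>m e. m \<ge> 1 \<Longrightarrow> V m e \<le> U m e" "profile_total N E V = T"
proof -
  have "\<exists>V. weyr_profile N E V \<and> (\<forall>m\<ge>1. \<forall>e. L m e \<le> V m e \<and> V m e \<le> U m e) \<and> profile_total N E V = T"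
    using U LU T
  proof (induction "profile_total N E U - T" arbitrary: U)
    case 0
    then show ?case by (intro exI[of _ U]) auto
  next
    case (Suc d)
    obtain V where V: "weyr_profile N E V" "\<And>m e. m \<ge> 1 \<Longrightarrow> L m e \<le> V m e"
      "\<And>m e. m \<ge> 1 \<Longrightarrow> V m e \<le> U m e" "profile_total N E U = Suc (profile_total N E V)"
      using weyr_profile_decrement[OF L Suc.prems(1) E Suc.prems(2)] Suc.prems(3) Suc.hyps(2)
      by (metis le_less_trans zero_less_Suc zero_less_diff)
    have "\<exists>W. weyr_profile N E W \<and> (\<forall>m\<ge>1. \<forall>e. L m e \<le> W m e \<and> W m e \<le> V m e) \<and> profile_total N E W = T"
      using V Suc.hyps(2) Suc.prems(3) by (intro Suc.hyps(1)) auto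
    then obtain W where W: "weyr_profile N E W" "profile_total N E W = T"
      and W': "\<And>m e. m \<ge> 1 \<Longrightarrow> L m e \<le> W m e \<and> W m e \<le> V m e" by blast
    have "L m e \<le> W m e \<and> W m e \<le> U m e" if "m \<ge> 1" for m e
      using W'[OF that, of e] V(3)[OF that, of e] by linarith
    with W show ?case by blast
  qed
  then show thesis using that by blast
qed

lemma weyr_profile_interpolate:
  assumes f: "weyr_profile N E f" and g: "weyr_profile N E g" and E: "finite E"
    and tot: "profile_total N E g = profile_total N E f"
    and close: "\<And>m e. m \<ge> 1 \<Longrightarrow> \<bar>int (f m e) - int (g m e)\<bar> \<le> int (Suc k)"
  obtains h where "weyr_profile N E h" "profile_total N E h = profile_total N E f"
    "\<And>m e. m \<ge> 1 \<Longrightarrow> \<bar>int (f m e) - int (h m e)\<bar> \<le> 1"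
    "\<And>m e. m \<ge> 1 \<Longrightarrow> \<bar>int (h m e) - int (g m e)\<bar> \<le> int k"
proof -
  \<comment> \<open>The two distance conditions on a natural number \<open>h\<close> say that it
    lies between \<open>L\<close> and the minimum of \<open>f + 1\<close> and \<open>g + k\<close>;
    truncated subtraction is harmless here. The cap by the maximum of \<open>f\<close> and
    \<open>g\<close> keeps \<open>U\<close> inside the window, since \<open>f + 1\<close> is
    positive everywhere.\<close>
  define L where "L m e = max (f m e - 1) (g m e - k)" for m e
  define U where "U m e = min (min (f m e + 1) (g m e + k)) (max (f m e) (g m e))" for m e
  have fg: "f m e \<le> g m e + Suc k" "g m e \<le> f m e + Suc k" if "m \<ge> 1" for m e
    using close[OF that, of e] by linarith+
  have mono: "f (Suc m) e \<le> f m e" "g (Suc m) e \<le> g m e" "f m e \<le> N" "g m e \<le> N"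
    if "m \<ge> 1" for m e
    by (rule weyr_profileD[OF f that] weyr_profileD[OF g that])+
  have supp: "e \<in> E \<and> m \<le> N" if "m \<ge> 1" "f m e \<noteq> 0 \<or> g m e \<noteq> 0" for m e
    using weyr_profileD(3,4)[OF f that(1)] weyr_profileD(3,4)[OF g that(1)] that(2) by blast
  have L: "weyr_profile N E L"
    unfolding weyr_profile_def
  proof (intro allI impI conjI)
    fix m e assume m: "(1::nat) \<le> m"
    show "L (Suc m) e \<le> L m e" "L m e \<le> N" using mono[OF m, of e] by (auto simp: L_def)
    assume "L m e \<noteq> 0"
    then have "f m e \<noteq> 0 \<or> g m e \<noteq> 0" by (auto simp: L_def)
    from supp[OF m this] show "e \<in> E" "m \<le> N" by auto
  qed
  have U: "weyr_profile N E U"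
    unfolding weyr_profile_def
  proof (intro allI impI conjI)
    fix m e assume m: "(1::nat) \<le> m"
    show "U (Suc m) e \<le> U m e" "U m e \<le> N" using mono[OF m, of e] by (auto simp: U_def)
    assume "U m e \<noteq> 0"
    then have "f m e \<noteq> 0 \<or> g m e \<noteq> 0" by (auto simp: U_def)
    from supp[OF m this] show "e \<in> E" "m \<le> N" by auto
  qed
  have LU: "L m e \<le> U m e" if "m \<ge> 1" for m e
    using fg[OF that, of e] by (auto simp: L_def U_def)
  \<comment> \<open>The real function \<open>(k f + g) / (k + 1)\<close> lies between \<open>L\<close> and \<open>U\<close> and has the right total.\<close>
  have avg: "Suc k * L m e \<le> k * f m e + g m e \<and> k * f m e + g m e \<le> Suc k * U m e"
    if "m \<ge> 1" for m e
  proof (cases "f m e \<le> g m e")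
    case True
    then obtain d where d: "g m e = f m e + d" using le_Suc_ex by blast
    then have "d \<le> Suc k" using fg(2)[OF that, of e] by simp
    \<comment> \<open>\<open>d - k\<close> is nonzero only in the extreme case
      \<open>d = Suc k\<close>, and there the mean equals \<open>f + 1\<close>.\<close>
    then have "L m e \<le> f m e + (d - k)" "(d = 0 \<and> U m e = f m e) \<or> (d \<noteq> 0 \<and> U m e = f m e + 1)"
      using d by (auto simp: L_def U_def)
    moreover have "Suc k * (d - k) \<le> d" using \<open>d \<le> Suc k\<close> by (cases "d = Suc k") auto
    moreover have "Suc k * L m e \<le> Suc k * (f m e + (d - k))"
      using calculation(1) by (rule mult_le_mono2)
    ultimately show ?thesis using \<open>d \<le> Suc k\<close> d by (auto simp: algebra_simps)
  next
    case False
    then obtain d where d: "f m e = g m e + d" using le_Suc_ex nat_le_linear by blast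
    then have dk: "d \<le> Suc k" "d \<noteq> 0" using fg(1)[OF that, of e] False by auto
    then have *: "L m e = g m e + d - 1" "U m e = g m e + min k d"
      using d by (auto simp: L_def U_def)
    have "Suc k * (d - 1) \<le> k * d" using dk by (cases d) auto
    moreover have "k * d \<le> Suc k * min k d"
      using dk by (cases "d = Suc k") auto
    ultimately show ?thesis using dk d * by (auto simp: algebra_simps)
  qed
  have total: "profile_total N E (\<lambda>m e. k * f m e + g m e) = Suc k * profile_total N E f"
    using tot unfolding profile_total_def by (simp add: sum.distrib sum_distrib_left split_def)
  have "Suc k * profile_total N E L \<le> Suc k * profile_total N E f"
    unfolding total[symmetric] unfolding profile_total_def sum_distrib_left
    using avg by (intro sum_mono) auto
  then have TL: "profile_total N E L \<le> profile_total N E f" by (simp only: Suc_mult_le_cancel1)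
  have "Suc k * profile_total N E f \<le> Suc k * profile_total N E U"
    unfolding total[symmetric] unfolding profile_total_def sum_distrib_left
    using avg by (intro sum_mono) auto
  then have TU: "profile_total N E f \<le> profile_total N E U" by (simp only: Suc_mult_le_cancel1)
  obtain h where h: "weyr_profile N E h" "\<And>m e. m \<ge> 1 \<Longrightarrow> L m e \<le> h m e"
    "\<And>m e. m \<ge> 1 \<Longrightarrow> h m e \<le> U m e" "profile_total N E h = profile_total N E f"
    using weyr_profile_between_exists[OF L U E LU TL TU] by blast
  have b: "f m e - 1 \<le> h m e" "g m e - k \<le> h m e" "h m e \<le> f m e + 1" "h m e \<le> g m e + k"
    if "m \<ge> 1" for m e
    using h(2)[OF that, of e] h(3)[OF that, of e] by (auto simp: L_def U_def)
  show thesis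
  proof (rule that[OF h(1,4)])
    show "\<bar>int (f m e) - int (h m e)\<bar> \<le> 1" if "m \<ge> 1" for m e
      using b(1,3)[OF that, of e] by linarith
    show "\<bar>int (h m e) - int (g m e)\<bar> \<le> int k" if "m \<ge> 1" for m e
      using b(2,4)[OF that, of e] by linarith
  qed
qed

lemma weyr_perturbation_exists:
  assumes "A \<in> carrier_mat n n" and "weyr_profile N E (weyr A)"
    and b: "weyr_profile N E b" and E: "finite E" and tot: "profile_total N E b = n"
    and "\<And>m e. m \<ge> 1 \<Longrightarrow> \<bar>int (weyr A m e) - int (b m e)\<bar> \<le> int k"
  shows "\<exists>R \<in> carrier_mat n n. vec_space.rank n R \<le> k \<and> (\<forall>m \<ge> 1. \<forall>e. weyr (A + R) m e = b m e)"
  using assms(1,2,6)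
proof (induction k arbitrary: A)
  case 0
  have "weyr (A + 0\<^sub>m n n) m e = b m e" if "m \<ge> 1" for m e
    using 0(3)[OF that, of e] 0(1) by simp
  then show ?case using vec_space.rank_0I[where 'a = complex]
    by (intro bexI[of _ "0\<^sub>m n n"]) auto
next
  case (Suc k)
  have tA: "profile_total N E (weyr A) = n" by (rule profile_total_weyr[OF Suc.prems(1,2) E])
  obtain h where h: "weyr_profile N E h" "profile_total N E h = n"
    "\<And>m e. m \<ge> 1 \<Longrightarrow> \<bar>int (weyr A m e) - int (h m e)\<bar> \<le> 1"
    "\<And>m e. m \<ge> 1 \<Longrightarrow> \<bar>int (h m e) - int (b m e)\<bar> \<le> int k"
    using weyr_profile_interpolate[OF Suc.prems(2) b E _ Suc.prems(3)] tA tot by metis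
  obtain R where R: "R \<in> carrier_mat n n" "vec_space.rank n R \<le> 1"
    and w: "\<And>m e. m \<ge> 1 \<Longrightarrow> weyr (A + R) m e = h m e"
    using weyr_rank_one_perturbation[OF Suc.prems(1,2) h(1) E h(2,3)] by blast
  have AR: "A + R \<in> carrier_mat n n" using R Suc.prems(1) by simp
  have "weyr_profile N E (weyr (A + R))" using h(1) weyr_profile_cong[of "weyr (A + R)" h, OF w] by simp
  then obtain R' where R': "R' \<in> carrier_mat n n" "vec_space.rank n R' \<le> k"
    "\<forall>m \<ge> 1. \<forall>e. weyr (A + R + R') m e = b m e"
    using Suc.IH[OF AR] h(4) w by auto
  have "vec_space.rank n (R + R') \<le> Suc k"
    using vec_space.rank_subadditive[OF R(1) R'(1)] R(2) R'(2) by simp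
  moreover have "A + R + R' = A + (R + R')" using Suc.prems(1) R R' by (intro assoc_add_mat) auto
  ultimately show ?case using R R' by (intro bexI[of _ "R + R'"]) auto
qed

lemma support_sum_eq_profile_total:
  assumes b: "weyr_profile N E b" and E: "finite E"
  shows "(\<Sum>e | \<exists>m \<ge> 1. b m e \<noteq> 0. \<Sum>m | m \<ge> 1 \<and> b m e \<noteq> 0. b m e) = profile_total N E b"
proof -
  have supp: "e \<in> E" "m \<le> N" if "m \<ge> 1" "b m e \<noteq> 0" for m e
    using weyr_profileD(3,4)[OF b that] by blast+
  have "profile_total N E b = (\<Sum>e\<in>E. \<Sum>m=1..N. b m e)"
    by (simp add: profile_total_def sum.cartesian_product)
  also have "\<dots> = (\<Sum>e\<in>E. \<Sum>m | m \<ge> 1 \<and> b m e \<noteq> 0. b m e)"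
    using supp by (intro sum.cong refl sum.mono_neutral_right) auto
  also have "\<dots> = (\<Sum>e | \<exists>m \<ge> 1. b m e \<noteq> 0. \<Sum>m | m \<ge> 1 \<and> b m e \<noteq> 0. b m e)"
    using supp E by (intro sum.mono_neutral_right) (auto intro!: sum.neutral)
  finally show ?thesis by simp
qed

section \<open>The bound for perturbations of rank k\<close>

lemma mult_mat_zero_vec:
  fixes A :: "'a :: semiring_0 mat"
  assumes "A \<in> carrier_mat nr nc"
  shows "A *\<^sub>v 0\<^sub>v nc = 0\<^sub>v nr"
  using assms by (intro eq_vecI) auto

context vec_space
begin

lemma kernel_dim_ge_card:
  assumes A: "A \<in> carrier_mat nr n" and S: "S \<subseteq> mat_kernel A" and "lin_indpt S"
  shows "card S \<le> kernel_dim A"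
proof -
  interpret K: kernel nr n A by (unfold_locales, rule A)
  obtain B where "finite B" "K.basis B" using kernel_basis_exists[OF A] by blast
  then have "K.Ker.fin_dim" unfolding K.Ker.fin_dim_def K.Ker.basis_def by blast
  from K.Ker.li_le_dim(2)[OF this S] assms(3) show ?thesis
    unfolding K.kernel_dim K.lindep_same[OF S] by simp
qed

lemma kernel_dim_basis:
  assumes A: "A \<in> carrier_mat nr n"
  obtains B where "finite B" "B \<subseteq> mat_kernel A" "lin_indpt B" "span B = mat_kernel A"
    "card B = kernel_dim A"
proof -
  interpret K: kernel nr n A by (unfold_locales, rule A)
  obtain B where B: "finite B" "K.basis B" using kernel_basis_exists[OF A] by blast
  then have sub: "B \<subseteq> mat_kernel A" and li: "K.lin_indpt B" and gen: "K.span B = mat_kernel A"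
    unfolding K.Ker.basis_def by auto
  from that[OF B(1) sub] li gen K.Ker.dim_basis[OF B] show thesis
    unfolding K.kernel_dim K.lindep_same[OF sub] K.span_same[OF sub] by simp
qed

lemma kernel_dim_le_card:
  assumes A: "A \<in> carrier_mat nr n" and S: "finite S" "S \<subseteq> carrier_vec n" "mat_kernel A \<subseteq> span S"
  shows "kernel_dim A \<le> card S"
proof -
  obtain B where B: "finite B" "B \<subseteq> mat_kernel A" "lin_indpt B" "card B = kernel_dim A"
    using kernel_dim_basis[OF A] by metis
  then have "B \<subseteq> span S" using S by blast
  from replacement[OF B(1) S(1) _ B(3) this] S(2) show ?thesis unfolding B(4) by auto
qed

section \<open>Subspaces and dimensions of quotients of kernels\<close>

lemma in_span_Un_decomp:
  assumes "C \<subseteq> carrier_vec n" "T \<subseteq> carrier_vec n" "v \<in> span (C \<union> T)"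
  obtains c t where "c \<in> span C" "t \<in> span T" "v = c + t"
  using assms span_union_is_sum[of C T] that unfolding submodule_sum_def by auto

definition vec_subspace :: "'a vec set \<Rightarrow> bool" where
  "vec_subspace Y \<longleftrightarrow> Y \<subseteq> carrier_vec n \<and> 0\<^sub>v n \<in> Y \<and> (\<forall>x\<in>Y. \<forall>y\<in>Y. x + y \<in> Y) \<and>
     (\<forall>c. \<forall>x\<in>Y. c \<cdot>\<^sub>v x \<in> Y)"

lemma vec_subspaceD:
  assumes "vec_subspace Y"
  shows "Y \<subseteq> carrier_vec n" "0\<^sub>v n \<in> Y" "x \<in> Y \<Longrightarrow> y \<in> Y \<Longrightarrow> x + y \<in> Y" "x \<in> Y \<Longrightarrow> c \<cdot>\<^sub>v x \<in> Y"
  using assms unfolding vec_subspace_def by auto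

lemma vec_subspace_diff:
  assumes "vec_subspace Y" "x \<in> Y" "y \<in> Y"
  shows "x - y \<in> Y"
proof -
  have "x - y = x + (-1) \<cdot>\<^sub>v y"
    using vec_subspaceD(1)[OF assms(1)] assms(2,3) by (intro eq_vecI) auto
  then show ?thesis using vec_subspaceD(3,4)[OF assms(1)] assms(2,3) by simp
qed

lemma span_vec_subspace:
  assumes Y: "vec_subspace Y" and C: "C \<subseteq> Y"
  shows "span C \<subseteq> Y"
proof -
  have "submodule class_ring Y V"
    using vec_subspaceD[OF Y] vec_neg
    by (auto simp: submodule_def module_vec_simps class_ring_simps vec_module)
  from span_is_subset[OF C this] show ?thesis .
qed

text \<open>The quotient of \<open>L\<close> by its intersection with \<open>ker Q'\<close> embeds in \<open>ker Q / ker Q'\<close> and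
  covers \<open>ker P / ker P'\<close> up to the span of \<open>Z\<close>.\<close>

lemma kernel_dim_quotient_le:
  assumes P: "P \<in> carrier_mat n n" and P': "P' \<in> carrier_mat n n"
    and Q: "Q \<in> carrier_mat n n" and Q': "Q' \<in> carrier_mat n n"
    and L: "vec_subspace L" "L \<subseteq> mat_kernel Q" "L \<inter> mat_kernel Q' \<subseteq> mat_kernel P'"
    and QQ: "mat_kernel Q' \<subseteq> mat_kernel Q"
    and Z: "finite Z" "Z \<subseteq> carrier_vec n"
    and cover: "\<And>y. y \<in> mat_kernel P \<Longrightarrow> \<exists>l\<in>L. \<exists>s\<in>span (mat_kernel P' \<union> Z). y = l + s"
  shows "kernel_dim P + kernel_dim Q' \<le> kernel_dim Q + kernel_dim P' + card Z"
proof -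
  obtain T where T: "finite T" "T \<subseteq> mat_kernel Q'" "lin_indpt T" "span T = mat_kernel Q'"
    "card T = kernel_dim Q'" by (rule kernel_dim_basis[OF Q'])
  obtain T' where T': "finite T'" "T' \<subseteq> mat_kernel P'" "span T' = mat_kernel P'"
    "card T' = kernel_dim P'" using kernel_dim_basis[OF P'] by metis
  have car: "mat_kernel Q' \<subseteq> carrier_vec n" "mat_kernel P' \<subseteq> carrier_vec n" "L \<subseteq> carrier_vec n"
    using mat_kernel_carrier[OF Q'] mat_kernel_carrier[OF P'] vec_subspaceD(1)[OF L(1)] by auto
  \<comment> \<open>A largest set \<open>C\<close> of this kind extends the basis \<open>T\<close>
    of \<open>ker Q'\<close> by vectors of \<open>L\<close>; it represents a basis of
    \<open>L\<close> modulo \<open>ker Q'\<close>.\<close>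
  let ?ok = "\<lambda>C. finite C \<and> C \<subseteq> L \<and> C \<inter> T = {} \<and> lin_indpt (C \<union> T)"
  have bound: "card C + card T \<le> kernel_dim Q" if "?ok C" for C
  proof -
    have "card (C \<union> T) \<le> kernel_dim Q"
      using that T(2) L(2) QQ by (intro kernel_dim_ge_card[OF Q]) auto
    then show ?thesis using that T(1) by (simp add: card_Un_disjoint)
  qed
  have "?ok {}" using T(3) by simp
  moreover have "\<forall>C. ?ok C \<longrightarrow> card C < Suc (kernel_dim Q)" using bound by fastforce
  ultimately obtain C where C: "?ok C" and max: "\<And>D. ?ok D \<Longrightarrow> card D \<le> card C"
    using ex_has_greatest_nat[of ?ok "{}" card "Suc (kernel_dim Q)"] by blast
  have Cc: "C \<subseteq> carrier_vec n" "T \<subseteq> carrier_vec n" "T' \<subseteq> carrier_vec n" using C T(2) T'(2) car by auto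
  have spanL: "L \<subseteq> span (C \<union> T)"
  proof (rule ccontr)
    assume "\<not> L \<subseteq> span (C \<union> T)"
    then obtain l where l: "l \<in> L" "l \<notin> span (C \<union> T)" by blast
    then have notin: "l \<notin> C \<union> T" using span_mem[of "C \<union> T" l] Cc by auto
    have "lin_indpt ((C \<union> T) \<union> {l})"
      using lin_dep_iff_in_span[of "C \<union> T" l] Cc C l notin car by auto
    then have "?ok (insert l C)" using C l notin by auto
    from max[OF this] show False using C notin by simp
  qed
  let ?S = "C \<union> T' \<union> Z"
  have Sc: "?S \<subseteq> carrier_vec n" using Cc Z by auto
  \<comment> \<open>The component of \<open>l\<close> along \<open>T\<close> is a difference of
    elements of \<open>L\<close>. It therefore lies in both \<open>L\<close> and
    \<open>ker Q'\<close>, hence in \<open>ker P'\<close>, and \<open>T'\<close> can replace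
    \<open>T\<close>.\<close>
  have LS: "l \<in> span ?S" if "l \<in> L" for l
  proof -
    have "l \<in> span (C \<union> T)" using that spanL by blast
    then obtain c t where ct: "c \<in> span C" "t \<in> span T" "l = c + t"
      by (rule in_span_Un_decomp[OF Cc(1,2)])
    have "c \<in> L" using span_vec_subspace[OF L(1)] C ct(1) by blast
    have tc: "t \<in> carrier_vec n" "c \<in> carrier_vec n" using ct T car \<open>c \<in> L\<close> by auto
    have "t = l - c" unfolding ct(3) using tc by (intro eq_vecI) auto
    then have "t \<in> L" using vec_subspace_diff[OF L(1) that \<open>c \<in> L\<close>] by simp
    then have "t \<in> span T'" using ct(2) T(4) T'(3) L(3) by blast
    then have "t \<in> span ?S" using span_is_monotone[of T' ?S] by blast
    moreover have "c \<in> span ?S" using ct(1) span_is_monotone[of C ?S] by blast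
    ultimately show ?thesis using span_add1[of ?S c t] Sc ct(3) by simp
  qed
  have "mat_kernel P' \<union> Z \<subseteq> span ?S"
    using span_is_monotone[of T' ?S] span_is_monotone[of Z ?S] T'(3) in_own_span[of Z] Z by auto
  then have sub: "span (mat_kernel P' \<union> Z) \<subseteq> span ?S" by (rule span_subsetI[OF Sc])
  have "mat_kernel P \<subseteq> span ?S"
  proof
    fix y assume "y \<in> mat_kernel P"
    then obtain l s where y: "y = l + s" and ls: "l \<in> L" "s \<in> span (mat_kernel P' \<union> Z)"
      using cover by blast
    from ls sub have "l \<in> span ?S" "s \<in> span ?S" using LS by blast+
    then show "y \<in> span ?S" unfolding y using span_add1[of ?S l s] Sc by simp
  qed
  from kernel_dim_le_card[OF P _ Sc this] have "kernel_dim P \<le> card ?S" using C T' Z by simp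
  also have "\<dots> \<le> card C + card T' + card Z"
    by (meson add_le_mono card_Un_le le_trans order_refl)
  finally show ?thesis using bound[OF C] T(5) T'(4) by simp
qed

text \<open>The correction is kept in the form \<open>c x + A w\<close> because only the multiple of
  \<open>x\<close> will cost a dimension: the vectors \<open>A w\<close> are going to lie in the
  kernel of the next lower power.\<close>

lemma functional_elimination:
  assumes Y: "vec_subspace Y" and A: "A \<in> carrier_mat n n" and f: "f \<in> carrier_vec n"
    and inv: "\<And>y. y \<in> Y \<Longrightarrow> A *\<^sub>v y \<in> Y" and nil: "\<And>y. y \<in> Y \<Longrightarrow> A ^\<^sub>m m *\<^sub>v y = 0\<^sub>v n"
  obtains x where "x \<in> Y" "\<And>y. y \<in> Y \<Longrightarrow>
    \<exists>y'\<in>Y. \<exists>w\<in>Y. \<exists>c. y = y' + (c \<cdot>\<^sub>v x + A *\<^sub>v w) \<and> (\<forall>i. f \<bullet> (A ^\<^sub>m i *\<^sub>v y') = 0)"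
proof (cases "\<exists>y\<in>Y. \<exists>i. f \<bullet> (A ^\<^sub>m i *\<^sub>v y) \<noteq> 0")
  case False
  have "y = y + (0 \<cdot>\<^sub>v 0\<^sub>v n + A *\<^sub>v 0\<^sub>v n)" if "y \<in> Y" for y
    using that vec_subspaceD(1)[OF Y] mult_mat_zero_vec[OF A] by auto
  then show thesis using False vec_subspaceD(2)[OF Y] that[of "0\<^sub>v n"] by blast
next
  case True
  note Yc = vec_subspaceD(1)[OF Y]
  have Ai: "A ^\<^sub>m i \<in> carrier_mat n n" for i using A by (rule pow_carrier_mat)
  have Ay: "A ^\<^sub>m i *\<^sub>v y \<in> carrier_vec n" if "y \<in> Y" for i y
    using Ai that Yc by (intro mult_mat_vec_carrier) auto
  have powY: "A ^\<^sub>m i *\<^sub>v y \<in> Y" if "y \<in> Y" for i y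
    using that
  proof (induction i arbitrary: y)
    case 0
    then show ?case using A Yc by auto
  next
    case (Suc i)
    have "A ^\<^sub>m Suc i *\<^sub>v y = A ^\<^sub>m i *\<^sub>v (A *\<^sub>v y)"
      using assoc_mult_mat_vec[OF Ai A] Suc.prems Yc by auto
    then show ?case using Suc.IH[OF inv[OF Suc.prems]] by simp
  qed
  have pow2: "A ^\<^sub>m i *\<^sub>v (A ^\<^sub>m j *\<^sub>v y) = A ^\<^sub>m (i + j) *\<^sub>v y" if "y \<in> Y" for i j y
    unfolding pow_mat_add[OF A] using assoc_mult_mat_vec[OF Ai Ai] that Yc by auto
  let ?nz = "\<lambda>i. \<exists>y\<in>Y. f \<bullet> (A ^\<^sub>m i *\<^sub>v y) \<noteq> 0"
  \<comment> \<open>Nilpotency on \<open>Y\<close> bounds these exponents, so a largest one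
    exists.\<close>
  have "i < m" if nz: "?nz i" for i
  proof (rule ccontr)
    assume "\<not> i < m"
    then have i: "i = (i - m) + m" by simp
    obtain y where y: "y \<in> Y" "f \<bullet> (A ^\<^sub>m i *\<^sub>v y) \<noteq> 0" using nz by blast
    have "A ^\<^sub>m i *\<^sub>v y = A ^\<^sub>m (i - m) *\<^sub>v (A ^\<^sub>m m *\<^sub>v y)" using pow2[OF y(1), of "i - m" m] i by simp
    also have "\<dots> = 0\<^sub>v n" unfolding nil[OF y(1)] by (rule mult_mat_zero_vec[OF Ai])
    finally show False using y f by simp
  qed
  moreover obtain i0 where "?nz i0" using True by blast
  ultimately obtain j where j: "?nz j" and jmax: "\<And>i. ?nz i \<Longrightarrow> i \<le> j"
    using ex_has_greatest_nat[of ?nz i0 id m] by (metis id_apply)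
  obtain x0 where x0: "x0 \<in> Y" "f \<bullet> (A ^\<^sub>m j *\<^sub>v x0) \<noteq> 0" using j by blast
  define x where "x = (1 / (f \<bullet> (A ^\<^sub>m j *\<^sub>v x0))) \<cdot>\<^sub>v x0"
  have x: "x \<in> Y" unfolding x_def using x0 by (intro vec_subspaceD(4)[OF Y])
  have lin: "f \<bullet> (A ^\<^sub>m i *\<^sub>v (y + c \<cdot>\<^sub>v z)) = f \<bullet> (A ^\<^sub>m i *\<^sub>v y) + c * (f \<bullet> (A ^\<^sub>m i *\<^sub>v z))"
    if "y \<in> Y" "z \<in> Y" for i y z c
  proof -
    have c: "y \<in> carrier_vec n" "z \<in> carrier_vec n" using that Yc by auto
    have "A ^\<^sub>m i *\<^sub>v (y + c \<cdot>\<^sub>v z) = A ^\<^sub>m i *\<^sub>v y + c \<cdot>\<^sub>v (A ^\<^sub>m i *\<^sub>v z)"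
      using mult_add_distrib_mat_vec[OF Ai[of i] c(1), of "c \<cdot>\<^sub>v z"] mult_mat_vec[OF Ai[of i] c(2), of c] c(2) by simp
    then show ?thesis
      using f Ay[OF that(1)] Ay[OF that(2)]
      by (simp add: scalar_prod_add_distrib[of _ n] scalar_prod_smult_right)
  qed
  have fx: "f \<bullet> (A ^\<^sub>m j *\<^sub>v x) = 1"
  proof -
    have "x = 0\<^sub>v n + (1 / (f \<bullet> (A ^\<^sub>m j *\<^sub>v x0))) \<cdot>\<^sub>v x0" unfolding x_def using x0 Yc by auto
    moreover have "A ^\<^sub>m j *\<^sub>v 0\<^sub>v n = 0\<^sub>v n" by (rule mult_mat_zero_vec[OF Ai])
    ultimately show ?thesis using lin[OF vec_subspaceD(2)[OF Y] x0(1)] x0(2) f by simp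
  qed
  \<comment> \<open>The exponents are cleared from the top, \<open>p\<close> of them so far. For
    \<open>p = 0\<close> the claim is the maximality of \<open>j\<close>; for
    \<open>p = Suc j\<close> every exponent is cleared. Writing \<open>Suc j <= i + p\<close> avoids
    truncated subtraction.\<close>
  have "\<exists>y'\<in>Y. \<exists>w\<in>Y. \<exists>c. y = y' + (c \<cdot>\<^sub>v x + A *\<^sub>v w) \<and>
      (\<forall>i. Suc j \<le> i + p \<longrightarrow> f \<bullet> (A ^\<^sub>m i *\<^sub>v y') = 0)" if y: "y \<in> Y" and "p \<le> Suc j" for y p
    using that(2)
  proof (induction p)
    case 0
    have "0 \<cdot>\<^sub>v x = 0\<^sub>v n" using x Yc by (intro eq_vecI) auto
    then have "y = y + (0 \<cdot>\<^sub>v x + A *\<^sub>v 0\<^sub>v n)" using y Yc mult_mat_zero_vec[OF A] by auto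
    moreover have "\<forall>i. Suc j \<le> i + 0 \<longrightarrow> f \<bullet> (A ^\<^sub>m i *\<^sub>v y) = 0" using jmax y by fastforce
    ultimately show ?case using y vec_subspaceD(2)[OF Y] by blast
  next
    case (Suc p)
    then obtain y' w c where IH: "y' \<in> Y" "w \<in> Y" "y = y' + (c \<cdot>\<^sub>v x + A *\<^sub>v w)"
      "\<And>i. Suc j \<le> i + p \<Longrightarrow> f \<bullet> (A ^\<^sub>m i *\<^sub>v y') = 0" by auto
    \<comment> \<open>The value still to be cleared, at exponent \<open>j - p\<close>. Subtracting
      \<open>d\<close> times A^p x cancels it because \<open>f\<close> is 1 on A^j x; at larger
      exponents the subtracted term contributes \<open>f\<close> on powers beyond \<open>j\<close>,
      which is 0.\<close>
    define d where "d = f \<bullet> (A ^\<^sub>m (j - p) *\<^sub>v y')"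
    have Apx: "A ^\<^sub>m p *\<^sub>v x \<in> Y" by (rule powY[OF x])
    define y'' where "y'' = y' + (- d) \<cdot>\<^sub>v (A ^\<^sub>m p *\<^sub>v x)"
    have y'': "y'' \<in> Y" unfolding y''_def using IH(1) Apx by (intro vec_subspaceD(3,4)[OF Y])
    have zero: "f \<bullet> (A ^\<^sub>m i *\<^sub>v y'') = 0" if "Suc j \<le> i + Suc p" for i
    proof -
      have e: "f \<bullet> (A ^\<^sub>m i *\<^sub>v y'') = f \<bullet> (A ^\<^sub>m i *\<^sub>v y') - d * (f \<bullet> (A ^\<^sub>m (i + p) *\<^sub>v x))"
        unfolding y''_def lin[OF IH(1) Apx] pow2[OF x] by simp
      show ?thesis
      proof (cases "i = j - p")
        case True
        then have "i + p = j" using Suc.prems by simp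
        then show ?thesis unfolding e using fx True by (simp add: d_def)
      next
        case False
        then have "Suc j \<le> i + p" using that by simp
        moreover from this have "f \<bullet> (A ^\<^sub>m (i + p) *\<^sub>v x) = 0" using jmax[of "i + p"] x by fastforce
        ultimately show ?thesis unfolding e using IH(4) by simp
      qed
    qed
    have yc: "y' \<in> carrier_vec n" "w \<in> carrier_vec n" "x \<in> carrier_vec n"
      "A ^\<^sub>m p *\<^sub>v x \<in> carrier_vec n" "A *\<^sub>v w \<in> carrier_vec n"
      using IH x Yc Apx A by auto
    have split: "y = y'' + (c \<cdot>\<^sub>v x + A *\<^sub>v w + d \<cdot>\<^sub>v (A ^\<^sub>m p *\<^sub>v x))"
      unfolding IH(3) y''_def using yc by (intro eq_vecI) (auto simp: algebra_simps)
    \<comment> \<open>Only the step \<open>p = 0\<close> changes the multiple of \<open>x\<close>;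
      each later correction is \<open>A\<close> applied to an element of \<open>Y\<close> and is
      absorbed into \<open>w\<close>.\<close>
    have "\<exists>w'\<in>Y. \<exists>c'. c \<cdot>\<^sub>v x + A *\<^sub>v w + d \<cdot>\<^sub>v (A ^\<^sub>m p *\<^sub>v x) = c' \<cdot>\<^sub>v x + A *\<^sub>v w'"
    proof (cases p)
      case 0
      have "c \<cdot>\<^sub>v x + A *\<^sub>v w + d \<cdot>\<^sub>v (A ^\<^sub>m p *\<^sub>v x) = (c + d) \<cdot>\<^sub>v x + A *\<^sub>v w"
        unfolding 0 using yc A by (intro eq_vecI) (auto simp: algebra_simps)
      then show ?thesis using IH(2) by blast
    next
      case (Suc p')
      have w: "w + d \<cdot>\<^sub>v (A ^\<^sub>m p' *\<^sub>v x) \<in> Y"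
        using IH(2) powY[OF x] by (intro vec_subspaceD(3,4)[OF Y])
      have "A *\<^sub>v (A ^\<^sub>m p' *\<^sub>v x) = A ^\<^sub>m p *\<^sub>v x"
        using pow2[OF x, of 1 p'] A Suc by simp
      then have "A *\<^sub>v (w + d \<cdot>\<^sub>v (A ^\<^sub>m p' *\<^sub>v x)) = A *\<^sub>v w + d \<cdot>\<^sub>v (A ^\<^sub>m p *\<^sub>v x)"
        using mult_add_distrib_mat_vec[OF A yc(2), of "d \<cdot>\<^sub>v (A ^\<^sub>m p' *\<^sub>v x)"]
          mult_mat_vec[OF A Ay[OF x, of p'], of d] Ay[OF x, of p'] by simp
      then have "c \<cdot>\<^sub>v x + A *\<^sub>v w + d \<cdot>\<^sub>v (A ^\<^sub>m p *\<^sub>v x) = c \<cdot>\<^sub>v x + A *\<^sub>v (w + d \<cdot>\<^sub>v (A ^\<^sub>m p' *\<^sub>v x))"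
        using yc by (simp add: assoc_add_vec[of _ n])
      then show ?thesis using w by blast
    qed
    then show ?case using split y'' zero by metis
  qed
  from this[of _ "Suc j"] show thesis using x that by simp
qed

lemma vec_subspace_annihilated:
  assumes X: "vec_subspace X" and A: "A \<in> carrier_mat n n" and fs: "set fs \<subseteq> carrier_vec n"
  shows "vec_subspace {y \<in> X. \<forall>f\<in>set fs. \<forall>i. f \<bullet> (A ^\<^sub>m i *\<^sub>v y) = 0}" (is "vec_subspace ?Y")
proof -
  note Xc = vec_subspaceD(1)[OF X]
  have Ai: "A ^\<^sub>m i \<in> carrier_mat n n" for i using A by (rule pow_carrier_mat)
  show ?thesis
    unfolding vec_subspace_def
  proof (intro conjI ballI allI)
    show "?Y \<subseteq> carrier_vec n" using Xc by blast
    show "0\<^sub>v n \<in> ?Y" using vec_subspaceD(2)[OF X] fs mult_mat_zero_vec[OF Ai] by auto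
    fix x assume x: "x \<in> ?Y"
    then have xc: "x \<in> carrier_vec n" using Xc by blast
    have Ax: "A ^\<^sub>m i *\<^sub>v x \<in> carrier_vec n" for i using Ai xc by (rule mult_mat_vec_carrier)
    have "g \<bullet> (A ^\<^sub>m i *\<^sub>v (c \<cdot>\<^sub>v x)) = 0" if "g \<in> set fs" for g i c
    proof -
      have "g \<in> carrier_vec n" using that fs by blast
      moreover have "g \<bullet> (A ^\<^sub>m i *\<^sub>v x) = 0" using that x by blast
      ultimately show ?thesis using Ax[of i] mult_mat_vec[OF Ai[of i] xc, of c] by simp
    qed
    then show "c \<cdot>\<^sub>v x \<in> ?Y" for c using x vec_subspaceD(4)[OF X] by blast
    fix y assume y: "y \<in> ?Y"
    then have yc: "y \<in> carrier_vec n" using Xc by blast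
    have Ay: "A ^\<^sub>m i *\<^sub>v y \<in> carrier_vec n" for i using Ai yc by (rule mult_mat_vec_carrier)
    have "g \<bullet> (A ^\<^sub>m i *\<^sub>v (x + y)) = 0" if "g \<in> set fs" for g i
    proof -
      have "g \<in> carrier_vec n" using that fs by blast
      moreover have "g \<bullet> (A ^\<^sub>m i *\<^sub>v x) = 0" "g \<bullet> (A ^\<^sub>m i *\<^sub>v y) = 0" using that x y by blast+
      ultimately show ?thesis
        using mult_add_distrib_mat_vec[OF Ai[of i] xc yc] scalar_prod_add_distrib[OF _ Ax[of i] Ay[of i], of g]
        by simp
    qed
    then show "x + y \<in> ?Y" using x y vec_subspaceD(3)[OF X] by blast
  qed
qed

text \<open>Each functional contributes one vector to \<open>Z\<close>. Demanding annihilation for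
  all powers makes the remaining subspace invariant under \<open>A\<close>, so the next functional
  can be eliminated inside it.\<close>

lemma functionals_elimination:
  assumes A: "A \<in> carrier_mat n n" and fs: "set fs \<subseteq> carrier_vec n"
    and X: "vec_subspace X" "\<And>y. y \<in> X \<Longrightarrow> A *\<^sub>v y \<in> X" "\<And>y. y \<in> X \<Longrightarrow> A ^\<^sub>m m *\<^sub>v y = 0\<^sub>v n"
    and W: "W \<subseteq> carrier_vec n" "\<And>y. y \<in> X \<Longrightarrow> A *\<^sub>v y \<in> W"
  shows "\<exists>Z. finite Z \<and> Z \<subseteq> carrier_vec n \<and> card Z \<le> length fs \<and>
    (\<forall>y\<in>X. \<exists>l\<in>{y \<in> X. \<forall>f\<in>set fs. \<forall>i. f \<bullet> (A ^\<^sub>m i *\<^sub>v y) = 0}. \<exists>s\<in>span (W \<union> Z). y = l + s)"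
  using fs
proof (induction fs)
  case Nil
  have "y = y + 0\<^sub>v n" if "y \<in> X" for y using that vec_subspaceD(1)[OF X(1)] by auto
  moreover have "0\<^sub>v n \<in> span (W \<union> {})" using span_empty span_is_monotone[of "{}" W] by auto
  ultimately show ?case by (intro exI[of _ "{}"]) auto
next
  case (Cons f fs)
  note Xc = vec_subspaceD(1)[OF X(1)]
  let ?Y = "\<lambda>fs. {y \<in> X. \<forall>f\<in>set fs. \<forall>i. f \<bullet> (A ^\<^sub>m i *\<^sub>v y) = 0}"
  from Cons obtain Z where Z: "finite Z" "Z \<subseteq> carrier_vec n" "card Z \<le> length fs"
    and dec: "\<And>y. y \<in> X \<Longrightarrow> \<exists>l\<in>?Y fs. \<exists>s\<in>span (W \<union> Z). y = l + s" by auto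
  have f: "f \<in> carrier_vec n" and fs: "set fs \<subseteq> carrier_vec n" using Cons.prems by auto
  have Ai: "A ^\<^sub>m i \<in> carrier_mat n n" for i using A by (rule pow_carrier_mat)
  have sub: "vec_subspace (?Y fs)" by (rule vec_subspace_annihilated[OF X(1) A fs])
  have inv: "A *\<^sub>v y \<in> ?Y fs" if y: "y \<in> ?Y fs" for y
  proof -
    have eq: "A ^\<^sub>m i *\<^sub>v (A *\<^sub>v y) = A ^\<^sub>m Suc i *\<^sub>v y" for i
      using assoc_mult_mat_vec[OF Ai A, of y i] y Xc by auto
    have "f \<bullet> (A ^\<^sub>m i *\<^sub>v (A *\<^sub>v y)) = 0" if "f \<in> set fs" for f i
      unfolding eq using y that by blast
    then show ?thesis using y X(2) by blast
  qed
  obtain x where x: "x \<in> ?Y fs" and el: "\<And>y. y \<in> ?Y fs \<Longrightarrow>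
    \<exists>y'\<in>?Y fs. \<exists>w\<in>?Y fs. \<exists>c. y = y' + (c \<cdot>\<^sub>v x + A *\<^sub>v w) \<and> (\<forall>i. f \<bullet> (A ^\<^sub>m i *\<^sub>v y') = 0)"
    using functional_elimination[OF sub A f inv, of m] X(3) by blast
  have xc: "x \<in> carrier_vec n" using x Xc by blast
  let ?Z = "insert x Z"
  have Zc: "W \<union> ?Z \<subseteq> carrier_vec n" using W(1) Z(2) xc by auto
  have "\<exists>l\<in>?Y (f # fs). \<exists>s\<in>span (W \<union> ?Z). y = l + s" if y: "y \<in> X" for y
  proof -
    obtain l s where ls: "l \<in> ?Y fs" "s \<in> span (W \<union> Z)" "y = l + s" using dec[OF y] by blast
    obtain l' w c where l': "l' \<in> ?Y fs" "w \<in> ?Y fs" "l = l' + (c \<cdot>\<^sub>v x + A *\<^sub>v w)"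
      "\<And>i. f \<bullet> (A ^\<^sub>m i *\<^sub>v l') = 0" using el[OF ls(1)] by blast
    have s: "s \<in> span (W \<union> ?Z)" using ls(2) span_is_monotone[of "W \<union> Z" "W \<union> ?Z"] by blast
    have cx: "c \<cdot>\<^sub>v x \<in> span (W \<union> ?Z)"
      using smult_in_span[OF Zc] span_mem[of "W \<union> ?Z" x] Zc by auto
    have Aw: "A *\<^sub>v w \<in> span (W \<union> ?Z)"
      using W(2)[of w] l'(2) span_mem[of "W \<union> ?Z" "A *\<^sub>v w"] Zc by auto
    have sum: "(c \<cdot>\<^sub>v x + A *\<^sub>v w) + s \<in> span (W \<union> ?Z)"
      using span_add1[of "W \<union> ?Z"] cx Aw s Zc by simp
    have "span (W \<union> ?Z) \<subseteq> carrier_vec n" using span_is_subset2[of "W \<union> ?Z"] Zc by simp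
    then have "s \<in> carrier_vec n" using s by blast
    moreover have "l' \<in> carrier_vec n" "c \<cdot>\<^sub>v x + A *\<^sub>v w \<in> carrier_vec n"
      using l'(1,2) Xc xc A by auto
    ultimately have "y = l' + ((c \<cdot>\<^sub>v x + A *\<^sub>v w) + s)" unfolding ls(3) l'(3) by (intro assoc_add_vec)
    moreover have "l' \<in> ?Y (f # fs)" using l'(1,4) by auto
    ultimately show ?thesis using sum by blast
  qed
  moreover have "card ?Z \<le> length (f # fs)" using Z card_insert_le_m1 by (simp add: card_insert_if)
  ultimately show ?case using Z xc by (intro exI[of _ ?Z]) auto
qed

text \<open>A rank factorization: the columns of \<open>R\<close> are expanded in a maximal
  independent set \<open>S\<close> of columns, and the coefficients belonging to each
  \<open>s\<close> form one functional. Then \<open>R x\<close> is the sum of the vectors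
  \<open>s\<close> weighted by the values of these functionals at \<open>x\<close>.\<close>

lemma rank_functionals:
  assumes R: "R \<in> carrier_mat n nc"
  obtains fs where "length fs = rank R" "set fs \<subseteq> carrier_vec nc"
    "\<And>x. x \<in> carrier_vec nc \<Longrightarrow> (\<forall>f\<in>set fs. f \<bullet> x = 0) \<Longrightarrow> R *\<^sub>v x = 0\<^sub>v n"
proof -
  have "lin_indpt {}" using lindep_span[of "{}"] by simp
  then obtain S where S: "finite S" "maximal S (\<lambda>T. T \<subseteq> set (cols R) \<and> lin_indpt T)"
    using maximal_exists_superset[of "set (cols R)" "\<lambda>T. T \<subseteq> set (cols R) \<and> lin_indpt T" "{}"] by auto
  have rank: "rank R = card S" by (rule rank_card_indpt[OF R S(2)])
  have Rc: "set (cols R) \<subseteq> carrier_vec n" using cols_dim[of R] R by auto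
  have SR: "S \<subseteq> set (cols R)" and li: "lin_indpt S" using S(2) by (auto simp: maximal_def)
  have Sc: "S \<subseteq> carrier_vec n" using SR Rc by blast
  have cols: "v \<in> span S" if v: "v \<in> set (cols R)" for v
  proof (rule ccontr)
    assume nv: "v \<notin> span S"
    then have "v \<notin> S" using span_mem[of S v] Sc by auto
    moreover have "lin_indpt (S \<union> {v})"
      using lin_dep_iff_in_span[of S v] Sc li nv v Rc calculation by auto
    ultimately show False using S(2) v SR unfolding maximal_def by (metis Un_insert_right insertI1 insert_subset subset_insertI sup_bot.right_neutral)
  qed
  have "\<exists>a. col R j = lincomb a S" if "j < nc" for j
  proof -
    have "col R j \<in> span S" using cols that R by (auto simp: cols_def)
    then show ?thesis using finite_in_span[of S "col R j"] S(1) Sc by (auto simp: eq_commute)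
  qed
  then obtain a where a: "\<And>j. j < nc \<Longrightarrow> col R j = lincomb (a j) S" by metis
  obtain ss where ss: "set ss = S" "distinct ss" using finite_distinct_list[OF S(1)] by blast
  define fs where "fs = map (\<lambda>s. vec nc (\<lambda>j. a j s)) ss"
  show thesis
  proof (rule that[of fs])
    show "length fs = rank R" using ss distinct_card[OF ss(2)] by (simp add: fs_def rank)
    show "set fs \<subseteq> carrier_vec nc" by (auto simp: fs_def)
    fix x assume x: "x \<in> carrier_vec nc" "\<forall>f\<in>set fs. f \<bullet> x = 0"
    have fx: "(\<Sum>j = 0..<nc. a j s * x $ j) = 0" if "s \<in> S" for s
      using x that ss unfolding fs_def by (auto simp: scalar_prod_def)
    show "R *\<^sub>v x = 0\<^sub>v n"
    proof (rule eq_vecI)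
      fix i assume "i < dim_vec (0\<^sub>v n)"
      then have i: "i < n" by simp
      have "(R *\<^sub>v x) $ i = (\<Sum>j = 0..<nc. col R j $ i * x $ j)"
        using i x R by (auto simp: scalar_prod_def intro!: sum.cong)
      also have "\<dots> = (\<Sum>j = 0..<nc. \<Sum>s\<in>S. a j s * s $ i * x $ j)"
        using a lincomb_index[OF i Sc] by (intro sum.cong) (auto simp: sum_distrib_right)
      also have "\<dots> = (\<Sum>s\<in>S. \<Sum>j = 0..<nc. a j s * s $ i * x $ j)" by (rule sum.swap)
      also have "\<dots> = (\<Sum>s\<in>S. s $ i * (\<Sum>j = 0..<nc. a j s * x $ j))"
        by (intro sum.cong refl) (simp add: sum_distrib_left mult.left_commute mult.assoc)
      also have "\<dots> = 0" using fx by simp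
      finally show "(R *\<^sub>v x) $ i = 0\<^sub>v n $ i" using i by simp
    qed (use R in auto)
  qed
qed

end


lemma (in vec_space) vec_subspace_mat_kernel:
  assumes "A \<in> carrier_mat nr n"
  shows "vec_subspace (mat_kernel A)"
  using assms mult_add_distrib_mat_vec[OF assms] mult_mat_vec[OF assms] mult_mat_zero_vec[OF assms]
  by (auto simp: vec_subspace_def mat_kernel[OF assms])

text \<open>The only link between \<open>A\<close> and \<open>B\<close> is their agreement on the
  common kernel of \<open>fs\<close>. This is symmetric, so exchanging them gives the reverse
  inequality with the same functionals.\<close>

lemma weyr_le_weyr_add_functionals:
  assumes A: "A \<in> carrier_mat n n" and B: "B \<in> carrier_mat n n"
    and fs: "set fs \<subseteq> carrier_vec n"
    and AB: "\<And>x. x \<in> carrier_vec n \<Longrightarrow> (\<forall>f\<in>set fs. f \<bullet> x = 0) \<Longrightarrow> B *\<^sub>v x = A *\<^sub>v x"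
    and m: "m \<ge> 1"
  shows "weyr A m ev \<le> weyr B m ev + length fs"
proof -
  interpret vec_space "TYPE(complex)" n .
  let ?a = "char_matrix A ev" and ?b = "char_matrix B ev"
  let ?X = "mat_kernel (?a ^\<^sub>m m)" and ?W = "mat_kernel (?a ^\<^sub>m (m - 1))"
  let ?L = "{y \<in> ?X. \<forall>f\<in>set fs. \<forall>i. f \<bullet> (?a ^\<^sub>m i *\<^sub>v y) = 0}"
  have a: "?a \<in> carrier_mat n n" and b: "?b \<in> carrier_mat n n" using A B by auto
  have ai: "?a ^\<^sub>m i \<in> carrier_mat n n" and bi: "?b ^\<^sub>m i \<in> carrier_mat n n" for i
    using a b by (auto intro: pow_carrier_mat)
  note aX = mat_kernel[OF ai] and bX = mat_kernel[OF bi]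
  have m': "m = (m - 1) + 1" "m = 1 + (m - 1)" using m by auto
  have am: "?a ^\<^sub>m (i + 1) *\<^sub>v y = ?a ^\<^sub>m i *\<^sub>v (?a *\<^sub>v y)"
    "?a ^\<^sub>m (1 + i) *\<^sub>v y = ?a *\<^sub>v (?a ^\<^sub>m i *\<^sub>v y)" if "y \<in> carrier_vec n" for i y
    using assoc_mult_mat_vec[OF ai[of i] a that] assoc_mult_mat_vec[OF a ai[of i] that]
      pow_mat_add[OF a, of 1 i] a by auto
  have bm: "?b ^\<^sub>m (1 + i) *\<^sub>v y = ?b *\<^sub>v (?b ^\<^sub>m i *\<^sub>v y)" if "y \<in> carrier_vec n" for i y
    using assoc_mult_mat_vec[OF b bi[of i] that] pow_mat_add[OF b, of 1 i] b by auto
  have X: "vec_subspace ?X" by (rule vec_subspace_mat_kernel[OF ai])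
  \<comment> \<open>Images under the shifted matrix drop to the lower kernel; this pays for the
    terms \<open>A w\<close> left by the elimination.\<close>
  have aW: "?a *\<^sub>v y \<in> ?W" if "y \<in> ?X" for y
    using that am(1)[of y "m - 1"] a m' unfolding aX by auto
  have inv: "?a *\<^sub>v y \<in> ?X" if "y \<in> ?X" for y
  proof -
    have y: "y \<in> carrier_vec n" "?a ^\<^sub>m m *\<^sub>v y = 0\<^sub>v n" using that unfolding aX by auto
    have "?a ^\<^sub>m m *\<^sub>v (?a *\<^sub>v y) = ?a *\<^sub>v (?a ^\<^sub>m m *\<^sub>v y)"
      using am[OF y(1), of m] by simp
    then show ?thesis using y a mult_mat_zero_vec[OF a] unfolding aX by auto
  qed
  obtain Z where Z: "finite Z" "Z \<subseteq> carrier_vec n" "card Z \<le> length fs"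
    and cover: "\<And>y. y \<in> ?X \<Longrightarrow> \<exists>l\<in>?L. \<exists>s\<in>span (?W \<union> Z). y = l + s"
    using functionals_elimination[OF a fs X inv _ _ aW, of m] unfolding aX by blast
  \<comment> \<open>Each iterate of \<open>y\<close> is itself annihilated by all functionals, so
    both matrices act on it alike. This is why \<open>?L\<close> demands vanishing for every
    power.\<close>
  have eq: "?b ^\<^sub>m i *\<^sub>v y = ?a ^\<^sub>m i *\<^sub>v y" if y: "y \<in> ?L" for i y
  proof (induction i)
    case 0
    show ?case using A B by (simp add: char_matrix_def)
  next
    case (Suc i)
    have yc: "y \<in> carrier_vec n" using y unfolding aX by blast
    let ?z = "?a ^\<^sub>m i *\<^sub>v y"
    have z: "?z \<in> carrier_vec n" using ai yc by (rule mult_mat_vec_carrier)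
    have "B *\<^sub>v ?z = A *\<^sub>v ?z" using y by (intro AB[OF z]) blast
    then have "?b *\<^sub>v ?z = ?a *\<^sub>v ?z"
      using add_mult_distrib_mat_vec[OF A _ z, of "(- ev) \<cdot>\<^sub>m 1\<^sub>m n"]
        add_mult_distrib_mat_vec[OF B _ z, of "(- ev) \<cdot>\<^sub>m 1\<^sub>m n"] A B
      by (simp add: char_matrix_def)
    then show ?case using bm[OF yc, of i] am(2)[OF yc, of i] Suc by simp
  qed
  have L: "vec_subspace ?L" by (rule vec_subspace_annihilated[OF X a fs])
  have LQ: "?L \<subseteq> mat_kernel (?b ^\<^sub>m m)"
  proof
    fix y assume y: "y \<in> ?L"
    then have "?a ^\<^sub>m m *\<^sub>v y = 0\<^sub>v n" "y \<in> carrier_vec n" unfolding aX by blast+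
    then show "y \<in> mat_kernel (?b ^\<^sub>m m)" using eq[OF y, of m] unfolding bX by simp
  qed
  have LW: "?L \<inter> mat_kernel (?b ^\<^sub>m (m - 1)) \<subseteq> ?W"
  proof
    fix y assume y: "y \<in> ?L \<inter> mat_kernel (?b ^\<^sub>m (m - 1))"
    then have "?b ^\<^sub>m (m - 1) *\<^sub>v y = 0\<^sub>v n" "y \<in> carrier_vec n" unfolding bX by blast+
    then show "y \<in> ?W" using eq[of y "m - 1"] y unfolding aX by simp
  qed
  have QQ: "mat_kernel (?b ^\<^sub>m (m - 1)) \<subseteq> mat_kernel (?b ^\<^sub>m m)"
    using bm[of _ "m - 1"] mult_mat_zero_vec[OF b] m' unfolding bX by auto
  have "kernel_dim (?a ^\<^sub>m m) + kernel_dim (?b ^\<^sub>m (m - 1)) \<le>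
      kernel_dim (?b ^\<^sub>m m) + kernel_dim (?a ^\<^sub>m (m - 1)) + card Z"
    by (rule kernel_dim_quotient_le[OF ai ai bi bi L LQ LW QQ Z(1,2) cover])
  then show ?thesis
    using weyr_dim_gen_eigenspace[OF A m, of ev] weyr_dim_gen_eigenspace[OF B m, of ev] Z(3)
    unfolding dim_gen_eigenspace_def by linarith
qed

lemma weyr_perturbation_bound:
  assumes A: "A \<in> carrier_mat n n" and R: "R \<in> carrier_mat n n" and m: "m \<ge> 1"
  shows "\<bar>int (weyr A m ev) - int (weyr (A + R) m ev)\<bar> \<le> int (vec_space.rank n R)"
proof -
  obtain fs where fs: "length fs = vec_space.rank n R" "set fs \<subseteq> carrier_vec n"
    and f: "\<And>x. x \<in> carrier_vec n \<Longrightarrow> (\<forall>f\<in>set fs. f \<bullet> x = 0) \<Longrightarrow> R *\<^sub>v x = 0\<^sub>v n"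
    using vec_space.rank_functionals[OF R] by metis
  have AR: "A + R \<in> carrier_mat n n" using R by simp
  have eq: "(A + R) *\<^sub>v x = A *\<^sub>v x" if "x \<in> carrier_vec n" "\<forall>f\<in>set fs. f \<bullet> x = 0" for x
    using add_mult_distrib_mat_vec[OF A R that(1)] f[OF that] mult_mat_vec_carrier[OF A that(1)] by simp
  show ?thesis
    using weyr_le_weyr_add_functionals[OF A AR fs(2) eq m, of ev]
      weyr_le_weyr_add_functionals[OF AR A fs(2) eq[symmetric] m, of ev] fs(1) by linarith
qed

theorem theorem2:
  fixes A :: "complex mat" and n k :: nat and \<mu> :: "nat \<Rightarrow> complex \<Rightarrow> nat"
  assumes "A \<in> carrier_mat n n"
    and "finite {(m, ev). m \<ge> 1 \<and> \<mu> m ev \<noteq> 0}"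
    and "\<forall>m \<ge> 1. \<forall>ev. \<mu> m ev \<ge> \<mu> (m + 1) ev"
  shows "(\<exists>R \<in> carrier_mat n n. vec_space.rank n R \<le> k \<and>
            (\<forall>m \<ge> 1. \<forall>ev. weyr (A + R) m ev = \<mu> m ev))
     \<longleftrightarrow>
         (\<forall>m \<ge> 1. \<forall>ev. \<bar>int (weyr A m ev) - int (\<mu> m ev)\<bar> \<le> int k) \<and>
         (\<Sum>ev | \<exists>m \<ge> 1. \<mu> m ev \<noteq> 0. \<Sum>m | m \<ge> 1 \<and> \<mu> m ev \<noteq> 0. \<mu> m ev) = n"
    (is "?lhs \<longleftrightarrow> ?bound \<and> ?sum = n")
proof
  assume ?lhs
  then obtain R where R: "R \<in> carrier_mat n n" "vec_space.rank n R \<le> k"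
    and w: "\<And>m ev. m \<ge> 1 \<Longrightarrow> weyr (A + R) m ev = \<mu> m ev" by blast
  have ?bound
  proof (intro allI impI)
    fix m ev assume m: "(1::nat) \<le> m"
    show "\<bar>int (weyr A m ev) - int (\<mu> m ev)\<bar> \<le> int k"
      using weyr_perturbation_bound[OF assms(1) R(1) m, of ev] R(2) w[OF m, of ev] by simp
  qed
  moreover have "?sum = n"
  proof -
    have AR: "A + R \<in> carrier_mat n n" using R(1) by simp
    obtain E where E: "finite E" "weyr_profile n E (weyr (A + R))"
      using weyr_profile_weyr[OF AR] by (metis order_refl)
    have "weyr_profile n E \<mu>" using E(2) weyr_profile_cong[of "weyr (A + R)" \<mu>, OF w] by simp
    from support_sum_eq_profile_total[OF this E(1)] show ?thesis
      using profile_total_weyr[OF AR E(2,1)] profile_total_cong[of "weyr (A + R)" \<mu>, OF w] by simp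
  qed
  ultimately show "?bound \<and> ?sum = n" ..
next
  assume rhs: "?bound \<and> ?sum = n"
  let ?S = "{(m, ev). m \<ge> 1 \<and> \<mu> m ev \<noteq> 0}"
  obtain E0 where E0: "finite E0"
    "\<And>N E. n \<le> N \<Longrightarrow> E0 \<subseteq> E \<Longrightarrow> weyr_profile N E (weyr A)"
    using weyr_profile_weyr[OF assms(1)] by metis
  define E where "E = E0 \<union> snd ` ?S"
  \<comment> \<open>A crude single bound that dominates \<open>n\<close> as well as every index and
    every value in the support of \<open>\<mu>\<close>.\<close>
  define N where "N = n + (\<Sum>(m, ev)\<in>?S. m + \<mu> m ev)"
  have E: "finite E" using E0(1) assms(2) by (simp add: E_def)
  have a: "weyr_profile N E (weyr A)" by (rule E0(2)) (auto simp: N_def E_def)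
  have S: "e \<in> E \<and> m \<le> N \<and> \<mu> m e \<le> N" if "m \<ge> 1" "\<mu> m e \<noteq> 0" for m e
  proof -
    have mem: "(m, e) \<in> ?S" using that by simp
    from member_le_sum[OF mem _ assms(2), of "\<lambda>(m, ev). m + \<mu> m ev"]
    have "m + \<mu> m e \<le> N" by (simp add: N_def)
    moreover have "e \<in> E" using mem by (force simp: E_def)
    ultimately show ?thesis by simp
  qed
  have b: "weyr_profile N E \<mu>"
    unfolding weyr_profile_def
  proof (intro allI impI conjI)
    fix m e assume m: "(1::nat) \<le> m"
    show "\<mu> (Suc m) e \<le> \<mu> m e" using assms(3) m by simp
    show "\<mu> m e \<le> N" using S[OF m, of e] by (cases "\<mu> m e = 0") auto
    assume "\<mu> m e \<noteq> 0"
    from S[OF m this] show "e \<in> E" "m \<le> N" by auto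
  qed
  have "profile_total N E \<mu> = n" using support_sum_eq_profile_total[OF b E] rhs by simp
  from weyr_perturbation_exists[OF assms(1) a b E this] rhs show ?lhs by blast
qed

end
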